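(* Let $n\ge3$ and let $x\in\mathbb{R}^{E_n}$ be a $\frac12$-cyclic point such that $H_x$ is a union of vertex-disjoint cycles of length 4. Define $y$ by $y_e=\frac54$ for $e\in W_x$, $y_e=\frac32x_e$ for $e\in H_x$, and $y_e=0$ for $e\notin E_x$. Then $y\in\mathrm{TSP}(K_n)$.
   Context: $K_n$ is the complete graph on $V_n=\{1,\dots,n\}$ with edge set $E_n$; $\delta(U)$ denotes the set of edges with exactly one endpoint in $U$. $\mathrm{SUBT}(K_n)=\{x\in[0,1]^{E_n}: x(\delta(\{i\}))=2\ \forall i,\ x(\delta(U))\ge2\ \forall\,\emptyset\ne U\subsetneq V_n\}$. A tour of $K_n$ is a connected, spanning, Eulerian multigraph on $V_n$ with edges (possibly repeated) from $E_n$; $\mathrm{TSP}(K_n)$ is the convex hull of multiplicity vectors of tours. $G_x=(V_n,E_x)$, $E_x=\{e:x_e>0\}$. A $\frac12$-cyclic point is $x\in\mathrm{SUBT}(K_n)\cap\{0,\frac12,1\}^{E_n}$ such that $G_x$ has maximum degree at most 3 and every vertex is incident to an edge $e$ with $x_e=1$; $W_x=\{e:x_e=1\}$, $H_x=\{e:x_e=\frac12\}$. *)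

theory Defs
  imports Complex_Main
begin

text \<open>Complete graph K_n: vertices {1..n}, edges = 2-element subsets.
  Real vectors indexed by E_n are represented as functions nat set => real
  that vanish outside E_n.\<close>

definition Vn :: "nat \<Rightarrow> nat set" where
  "Vn n = {1..n}"

definition En :: "nat \<Rightarrow> nat set set" where
  "En n = {e. e \<subseteq> Vn n \<and> card e = 2}"

definition delta :: "nat \<Rightarrow> nat set \<Rightarrow> nat set set" where
  "delta n U = {e \<in> En n. card (e \<inter> U) = 1}"

definition SUBT :: "nat \<Rightarrow> (nat set \<Rightarrow> real) set" where
  "SUBT n = {x. (\<forall>e. e \<notin> En n \<longrightarrow> x e = 0)
     \<and> (\<forall>e\<in>En n. 0 \<le> x e \<and> x e \<le> 1)
     \<and> (\<forall>i\<in>Vn n. sum x (delta n {i}) = 2)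
     \<and> (\<forall>U. U \<noteq> {} \<and> U \<subset> Vn n \<longrightarrow> sum x (delta n U) \<ge> 2)}"

text \<open>A tour is given by its multiplicity vector m (edge multiplicities):
  a multigraph on V_n with edges from E_n that is connected and spanning
  and Eulerian (every vertex has even degree).\<close>

definition mg_adj :: "(nat set \<Rightarrow> nat) \<Rightarrow> nat \<Rightarrow> nat \<Rightarrow> bool" where
  "mg_adj m u v \<longleftrightarrow> u \<noteq> v \<and> m {u, v} > 0"

definition mg_degree :: "nat \<Rightarrow> (nat set \<Rightarrow> nat) \<Rightarrow> nat \<Rightarrow> nat" where
  "mg_degree n m v = (\<Sum>e\<in>{e \<in> En n. v \<in> e}. m e)"

definition is_tour :: "nat \<Rightarrow> (nat set \<Rightarrow> nat) \<Rightarrow> bool" where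
  "is_tour n m \<longleftrightarrow> (\<forall>e. e \<notin> En n \<longrightarrow> m e = 0)
     \<and> (\<forall>u\<in>Vn n. \<forall>v\<in>Vn n. (mg_adj m)\<^sup>*\<^sup>* u v)
     \<and> (\<forall>v\<in>Vn n. even (mg_degree n m v))"

definition TSP_Kn :: "nat \<Rightarrow> (nat set \<Rightarrow> real) set" where
  "TSP_Kn n = {y. \<exists>(k::nat) (c::nat \<Rightarrow> real) (t::nat \<Rightarrow> nat set \<Rightarrow> nat). (\<forall>i<k. c i \<ge> 0) \<and> (\<Sum>i<k. c i) = (1::real)
      \<and> (\<forall>i<k. is_tour n (t i))
      \<and> (\<forall>e. y e = (\<Sum>i<k. c i * real (t i e)))}"

definition supp_edges :: "nat \<Rightarrow> (nat set \<Rightarrow> real) \<Rightarrow> nat set set" where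
  "supp_edges n x = {e \<in> En n. x e > 0}"

definition W_edges :: "nat \<Rightarrow> (nat set \<Rightarrow> real) \<Rightarrow> nat set set" where
  "W_edges n x = {e \<in> En n. x e = 1}"

definition H_edges :: "nat \<Rightarrow> (nat set \<Rightarrow> real) \<Rightarrow> nat set set" where
  "H_edges n x = {e \<in> En n. x e = 1/2}"

definition half_cyclic :: "nat \<Rightarrow> (nat set \<Rightarrow> real) \<Rightarrow> bool" where
  "half_cyclic n x \<longleftrightarrow> x \<in> SUBT n
     \<and> (\<forall>e\<in>En n. x e \<in> {0, 1/2, 1})
     \<and> (\<forall>v\<in>Vn n. card {e \<in> supp_edges n x. v \<in> e} \<le> 3)
     \<and> (\<forall>v\<in>Vn n. \<exists>e\<in>En n. v \<in> e \<and> x e = 1)"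

definition is_C4 :: "nat \<Rightarrow> nat set set \<Rightarrow> bool" where
  "is_C4 n F \<longleftrightarrow> (\<exists>a b c d. distinct [a, b, c, d] \<and> {a, b, c, d} \<subseteq> Vn n
       \<and> F = {{a, b}, {b, c}, {c, d}, {d, a}})"

definition union_disjoint_C4 :: "nat \<Rightarrow> nat set set \<Rightarrow> bool" where
  "union_disjoint_C4 n H \<longleftrightarrow> (\<exists>\<C>. (\<forall>F\<in>\<C>. is_C4 n F) \<and> \<Union>\<C> = H
       \<and> (\<forall>F\<in>\<C>. \<forall>G\<in>\<C>. F \<noteq> G \<longrightarrow> \<Union>F \<inter> \<Union>G = {}))"

end

(*
  Every vertex lies on exactly one square (a 4-cycle of half edges) and one 1-edge, or on two 1-edges.
  By an argument of Kotzig, in every square one can choose a pair of opposite edges, its rails, so that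
  the 1-edges and the rails connect the whole graph; the other two edges of the square are its rungs.

  Contract all rungs and merge the two rails of each square into one edge. In the resulting cubic graph
  give weight 1/4 to the 1-edges and 1/2 to the merged rails. The cut conditions of x say precisely that
  this vector satisfies Edmonds' odd cut inequalities, so it is a convex combination of perfect matchings.
  A matching M becomes a tour as follows. The 1-edges in M are doubled. A square whose merged rail is in M
  contributes both rails and no rung. In any other square exactly one end of each rung carries a
  doubled 1-edge, and the square contributes one of its rails and both rungs, with multiplicities 1 or 2
  determined by parity; it is thus connected, so connectivity of the tour follows from that of 1-edges and rails.
  Averaging over the two choices of the rail, the rungs of such a square get 3/2 each,
  and altogether 1-edges get 1 + 1/4, rails 1/2 + 1/4, and rungs 1/2 * 3/2.
*)
theory Submission
  imports Defs "HOL-Probability.Probability_Mass_Function"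
begin

section \<open>The perfect matching polytope\<close>

text \<open>A matching that uses a merged rail removes both rungs of its square, so only rails and
  1-edges can be relied on to hold a tour together. This is why the rails of all squares are fixed
  before any matching is drawn: the same choice has to work for every perfect matching in the
  combination. The weight 1/4 is the surplus 5/4 - 1, the probability with which a 1-edge has to be
  doubled; 1/2 is then what remains at a contracted rung with two 1-edges. For the odd cuts, parity
  leaves a single dangerous configuration: a cut that consists of one merged rail and has weight
  1/2. Pulled back to the original graph, it is crossed by no 1-edge and only by the two rails of
  one square, so its x-value is 1, contrary to x(delta(U)) >= 2. The constraints on larger sets thus
  act twice: weakly, as the connectivity from which Kotzig's argument starts, and with full strength
  against this configuration.\<close>

definition cut :: "('e \<Rightarrow> 'v set) \<Rightarrow> 'v set \<Rightarrow> 'e set" where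
  "cut inc U = {e. inc e \<inter> U \<noteq> {} \<and> \<not> inc e \<subseteq> U}"

text \<open>Edges are abstract tokens with an end map \<open>inc\<close>, because contraction makes
  edges parallel while they have to stay distinguishable. \<open>cut\<close> is not restricted to
  the edge set, hence the recurring \<open>E \<inter> cut inc U\<close>.\<close>

definition graph :: "('e \<Rightarrow> 'v set) \<Rightarrow> 'v set \<Rightarrow> 'e set \<Rightarrow> bool" where
  "graph inc V E \<longleftrightarrow> finite V \<and> finite E \<and> (\<forall>e\<in>E. inc e \<subseteq> V \<and> card (inc e) = 2)"

definition perfect_matching :: "('e \<Rightarrow> 'v set) \<Rightarrow> 'v set \<Rightarrow> 'e set \<Rightarrow> 'e set \<Rightarrow> bool" where
  "perfect_matching inc V E M \<longleftrightarrow> M \<subseteq> E \<and> (\<forall>v\<in>V. card (M \<inter> cut inc {v}) = 1)"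

definition edmonds :: "('e \<Rightarrow> 'v set) \<Rightarrow> 'v set \<Rightarrow> 'e set \<Rightarrow> ('e \<Rightarrow> real) \<Rightarrow> bool" where
  "edmonds inc V E x \<longleftrightarrow> graph inc V E \<and> (\<forall>e\<in>E. 0 \<le> x e)
     \<and> (\<forall>v\<in>V. sum x (E \<inter> cut inc {v}) = 1)
     \<and> (\<forall>U\<subseteq>V. odd (card U) \<longrightarrow> 1 \<le> sum x (E \<inter> cut inc U))"

text \<open>A convex combination of perfect matchings is encoded as a probability distribution with
  marginals \<open>x\<close>; gluing two combinations then becomes a coupling.\<close>

definition pm_hull :: "('e \<Rightarrow> 'v set) \<Rightarrow> 'v set \<Rightarrow> 'e set \<Rightarrow> ('e \<Rightarrow> real) \<Rightarrow> bool" where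
  "pm_hull inc V E x \<longleftrightarrow> (\<exists>p. set_pmf p \<subseteq> {M. perfect_matching inc V E M}
     \<and> (\<forall>e\<in>E. measure_pmf.prob p {M. e \<in> M} = x e))"

lemma graphD:
  assumes "graph inc V E" "e \<in> E"
  obtains u v where "inc e = {u, v}" "u \<noteq> v" "u \<in> V" "v \<in> V"
proof -
  have "inc e \<subseteq> V" "card (inc e) = 2" using assms by (auto simp: graph_def)
  then obtain u v where "inc e = {u,v}" "u \<noteq> v" by (meson card_2_iff)
  with \<open>inc e \<subseteq> V\<close> show thesis using that by auto
qed

lemma graph_other_end:
  assumes "graph inc V E" "e \<in> E" "v \<in> inc e"
  obtains u where "inc e = {v, u}" "u \<noteq> v" "u \<in> V"
proof -
  obtain a b where ab: "inc e = {a, b}" "a \<noteq> b" "a \<in> V" "b \<in> V" using graphD[OF assms(1,2)] .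
  show thesis
  proof (cases "v = a")
    case True
    then show thesis using that[of b] ab by auto
  next
    case False
    then show thesis using that[of a] ab assms(3) by auto
  qed
qed

lemma cut_single:
  assumes "graph inc V E" "e \<in> E"
  shows "e \<in> cut inc {v} \<longleftrightarrow> v \<in> inc e"
proof -
  obtain a b where "inc e = {a, b}" "a \<noteq> b" using graphD[OF assms] .
  then show ?thesis by (auto simp: cut_def)
qed

lemma cut_complement:
  assumes "graph inc V E"
  shows "E \<inter> cut inc (V - U) = E \<inter> cut inc U"
proof -
  have "e \<in> cut inc (V - U) \<longleftrightarrow> e \<in> cut inc U" if e: "e \<in> E" for e
  proof -
    obtain u v where "inc e = {u, v}" "u \<noteq> v" "u \<in> V" "v \<in> V" using graphD[OF assms e] .
    then show ?thesis by (auto simp: cut_def)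
  qed
  then show ?thesis by blast
qed

text \<open>The cut of \<open>V\<close> is empty, so for odd \<open>V\<close> the inequality at
  \<open>U = V\<close> would read 1 <= 0. Evenness makes complements of odd sets odd.\<close>

lemma edmonds_even:
  assumes "edmonds inc V E x"
  shows "even (card V)"
proof (rule ccontr)
  assume "odd (card V)"
  then have "1 \<le> sum x (E \<inter> cut inc V)" using assms by (auto simp: edmonds_def)
  moreover have "E \<inter> cut inc V = {}"
    using assms by (auto simp: edmonds_def graph_def cut_def)
  ultimately show False by simp
qed

lemma pm_hull_delete:
  assumes "pm_hull inc V (E - {e}) x" "x e = 0"
  shows "pm_hull inc V E x"
proof -
  obtain p where p: "set_pmf p \<subseteq> {M. perfect_matching inc V (E - {e}) M}"
    "\<forall>f\<in>E - {e}. measure_pmf.prob p {M. f \<in> M} = x f"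
    using assms(1) by (auto simp: pm_hull_def)
  have "measure_pmf.prob p {M. e \<in> M} = 0"
    using p(1) by (auto simp: measure_pmf_zero_iff perfect_matching_def)
  with p assms(2) show ?thesis
    unfolding pm_hull_def by (intro exI[of _ p]) (fastforce simp: perfect_matching_def)
qed

lemma edmonds_delete:
  assumes "edmonds inc V E x" "x e = 0"
  shows "edmonds inc V (E - {e}) x"
proof -
  have *: "sum x ((E - {e}) \<inter> A) = sum x (E \<inter> A)" for A
    using assms by (intro sum.mono_neutral_left) (auto simp: edmonds_def graph_def)
  show ?thesis using assms by (auto simp: edmonds_def graph_def *)
qed

lemma pm_hull_mix:
  assumes "pm_hull inc V E x" "pm_hull inc V E y" "0 \<le> t" "t \<le> (1::real)"
  shows "pm_hull inc V E (\<lambda>e. t * x e + (1 - t) * y e)"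
proof -
  obtain p q where p: "set_pmf p \<subseteq> {M. perfect_matching inc V E M}"
    "\<forall>f\<in>E. measure_pmf.prob p {M. f \<in> M} = x f"
    and q: "set_pmf q \<subseteq> {M. perfect_matching inc V E M}"
    "\<forall>f\<in>E. measure_pmf.prob q {M. f \<in> M} = y f"
    using assms(1,2) by (auto simp: pm_hull_def)
  define m where "m = bernoulli_pmf t \<bind> (\<lambda>b. if b then p else q)"
  have "measure_pmf.prob m A = t * measure_pmf.prob p A + (1 - t) * measure_pmf.prob q A" for A
    using assms(3,4) unfolding m_def measure_pmf_bind
    by (subst measure_pmf.measure_bind[where N = "count_space UNIV"])
      (auto intro!: measure_pmf_in_subprob_algebra)
  then show ?thesis
    unfolding pm_hull_def using p q
    by (intro exI[of _ m]) (auto simp: m_def split: if_splits)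
qed

section \<open>Contracting the sides of a tight odd cut and gluing matchings\<close>

text \<open>\<open>\<phi>\<close> shrinks \<open>V - S\<close> to its own member \<open>t\<close>,
  so no new vertex is needed and edges and \<open>x\<close> keep their names. Edges inside
  \<open>V - S\<close> would become loops and are dropped; every cut of the contraction is the cut
  of a preimage under \<open>\<phi>\<close>.\<close>

lemma cut_contract:
  assumes gr: "graph inc V E" and S: "S \<subseteq> V" and t: "t \<in> V - S"
  defines "\<phi> \<equiv> \<lambda>v. if v \<in> S then v else t"
  shows "{e \<in> E. inc e \<inter> S \<noteq> {}} \<inter> cut (\<lambda>e. \<phi> ` inc e) U = E \<inter> cut inc (\<phi> -` U \<inter> V)"
    and "{e \<in> E. inc e \<inter> S \<noteq> {}} \<inter> cut (\<lambda>e. \<phi> ` inc e) {t} = E \<inter> cut inc S"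
    and "v \<in> S \<Longrightarrow> {e \<in> E. inc e \<inter> S \<noteq> {}} \<inter> cut (\<lambda>e. \<phi> ` inc e) {v} = E \<inter> cut inc {v}"
proof -
  let ?E = "{e \<in> E. inc e \<inter> S \<noteq> {}}"
  show *: "?E \<inter> cut (\<lambda>e. \<phi> ` inc e) U = E \<inter> cut inc (\<phi> -` U \<inter> V)" for U
  proof -
    have "(e \<in> ?E \<and> e \<in> cut (\<lambda>e. \<phi> ` inc e) U) \<longleftrightarrow> e \<in> cut inc (\<phi> -` U \<inter> V)" if e: "e \<in> E" for e
    proof -
      obtain u v where uv: "inc e = {u, v}" "u \<noteq> v" "u \<in> V" "v \<in> V" using graphD[OF gr e] .
      show ?thesis using e uv t by (auto simp: cut_def \<phi>_def)
    qed
    then show ?thesis by blast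
  qed
  have "\<phi> -` {t} \<inter> V = V - S" using t by (auto simp: \<phi>_def)
  then show "?E \<inter> cut (\<lambda>e. \<phi> ` inc e) {t} = E \<inter> cut inc S"
    using * cut_complement[OF gr] by metis
  show "?E \<inter> cut (\<lambda>e. \<phi> ` inc e) {v} = E \<inter> cut inc {v}" if "v \<in> S"
  proof -
    have "\<phi> -` {v} \<inter> V = {v}" using that S t by (auto simp: \<phi>_def)
    then show ?thesis using * by metis
  qed
qed

text \<open>Tightness of the cut is the degree equation at \<open>t\<close>. An odd set through
  \<open>t\<close> pulls back to one in which \<open>t\<close> is replaced by all of
  \<open>V - S\<close>, and it stays odd because \<open>V - S\<close> is odd.\<close>

lemma edmonds_contract:
  assumes ed: "edmonds inc V E x" and S: "S \<subseteq> V" "odd (card S)" and t: "t \<in> V - S"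
    and tight: "sum x (E \<inter> cut inc S) = 1"
  defines "\<phi> \<equiv> \<lambda>v. if v \<in> S then v else t"
  shows "edmonds (\<lambda>e. \<phi> ` inc e) (insert t S) {e \<in> E. inc e \<inter> S \<noteq> {}} x"
proof -
  have gr: "graph inc V E" and fin: "finite V" "finite E"
    using ed by (auto simp: edmonds_def graph_def)
  let ?E = "{e \<in> E. inc e \<inter> S \<noteq> {}}"
  note cut = cut_contract(1)[OF gr S(1) t, folded \<phi>_def]
  have "odd (card (V - S))"
    using S edmonds_even[OF ed] fin card_mono[OF fin(1) S(1)]
    by (simp add: card_Diff_subset finite_subset)
  have gr': "graph (\<lambda>e. \<phi> ` inc e) (insert t S) ?E"
  proof -
    have "\<phi> ` inc e \<subseteq> insert t S \<and> card (\<phi> ` inc e) = 2" if e: "e \<in> ?E" for e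
    proof -
      obtain u v where uv: "inc e = {u, v}" "u \<noteq> v" "u \<in> V" "v \<in> V" using graphD[OF gr] e by auto
      have "\<phi> u \<noteq> \<phi> v" using e uv t by (auto simp: \<phi>_def)
      moreover have "\<phi> ` inc e = {\<phi> u, \<phi> v}" using uv(1) by simp
      moreover have "\<phi> u \<in> insert t S" "\<phi> v \<in> insert t S" by (simp_all add: \<phi>_def)
      ultimately show ?thesis by simp
    qed
    then show ?thesis using fin S by (auto simp: graph_def finite_subset)
  qed
  have v1: "sum x (?E \<inter> cut (\<lambda>e. \<phi> ` inc e) {v}) = 1" if "v \<in> insert t S" for v
  proof (cases "v = t")
    case True
    then show ?thesis using cut_contract(2)[OF gr S(1) t, folded \<phi>_def] tight by simp
  next
    case False
    then have v: "v \<in> S" "v \<in> V" using that S by auto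
    have "sum x (E \<inter> cut inc {v}) = 1" using v(2) ed by (simp add: edmonds_def)
    then show ?thesis using cut_contract(3)[OF gr S(1) t v(1), folded \<phi>_def] by simp
  qed
  have U1: "1 \<le> sum x (?E \<inter> cut (\<lambda>e. \<phi> ` inc e) U)" if "U \<subseteq> insert t S" "odd (card U)" for U
  proof -
    have "odd (card (\<phi> -` U \<inter> V))"
    proof (cases "t \<in> U")
      case False
      then have "\<phi> -` U \<inter> V = U" using that S by (auto simp: \<phi>_def split: if_splits)
      then show ?thesis using that by simp
    next
      case True
      then have eq: "\<phi> -` U \<inter> V = (U - {t}) \<union> (V - S)" using that S t by (auto simp: \<phi>_def)
      have "finite U" using that fin S by (meson finite_insert finite_subset)
      then have "card ((U - {t}) \<union> (V - S)) = card (U - {t}) + card (V - S)"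
        using that fin by (intro card_Un_disjoint) auto
      moreover have "card (U - {t}) = card U - 1" "card U \<noteq> 0"
        using True \<open>finite U\<close> by auto
      ultimately show ?thesis using that eq \<open>odd (card (V - S))\<close> by simp
    qed
    then show ?thesis using ed cut by (simp add: edmonds_def)
  qed
  show ?thesis
    unfolding edmonds_def
  proof (intro conjI ballI allI impI)
    show "0 \<le> x e" if "e \<in> ?E" for e using that ed by (simp add: edmonds_def)
  qed (fact gr' v1 U1)+
qed

lemma perfect_matching_card_cut:
  assumes "perfect_matching inc V E M" "v \<in> V"
  obtains e where "M \<inter> cut inc {v} = {e}"
proof -
  have "card (M \<inter> cut inc {v}) = 1" using assms by (auto simp: perfect_matching_def)
  then show thesis using that card_1_singletonE by blast
qed

text \<open>In both contractions a matching meets the cut \<open>C\<close> in exactly one edge, and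
  this edge has the same law on both sides, namely \<open>x\<close> on \<open>C\<close>. So a
  matching of one side can be completed by one of the other side, conditioned on using the same edge
  of \<open>C\<close>, without disturbing either distribution.\<close>

lemma pm_hull_glue:
  assumes gr: "graph inc V E" and S: "S \<subseteq> V" and t: "t \<in> V - S" and s: "s \<in> S"
  defines "E1 \<equiv> {e \<in> E. inc e \<inter> S \<noteq> {}}" and "E2 \<equiv> {e \<in> E. inc e \<inter> (V - S) \<noteq> {}}"
  assumes h1: "pm_hull (\<lambda>e. (\<lambda>v. if v \<in> S then v else t) ` inc e) (insert t S) E1 x"
    and h2: "pm_hull (\<lambda>e. (\<lambda>v. if v \<in> V - S then v else s) ` inc e) (insert s (V - S)) E2 x"
  shows "pm_hull inc V E x"
proof -
  let ?i1 = "\<lambda>e. (\<lambda>v. if v \<in> S then v else t) ` inc e"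
  let ?i2 = "\<lambda>e. (\<lambda>v. if v \<in> V - S then v else s) ` inc e"
  define C where "C = E \<inter> cut inc S"
  have C12: "C = E1 \<inter> E2"
  proof -
    have "e \<in> cut inc S \<longleftrightarrow> inc e \<inter> S \<noteq> {} \<and> inc e \<inter> (V - S) \<noteq> {}" if e: "e \<in> E" for e
    proof -
      obtain u v where "inc e = {u, v}" "u \<noteq> v" "u \<in> V" "v \<in> V" using graphD[OF gr e] .
      then show ?thesis by (auto simp: cut_def)
    qed
    then show ?thesis by (auto simp: C_def E1_def E2_def)
  qed
  have E12: "E = E1 \<union> E2"
    using gr unfolding E1_def E2_def graph_def by (fastforce simp: card_2_iff)
  note star1 = cut_contract(2)[OF gr S t, folded E1_def C_def]
    and v1 = cut_contract(3)[OF gr S t, folded E1_def]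
  have s': "s \<in> V - (V - S)" using s S by blast
  have star2: "E2 \<inter> cut ?i2 {s} = C"
    using cut_contract(2)[OF gr Diff_subset s'] cut_complement[OF gr] by (simp add: E2_def C_def)
  note v2 = cut_contract(3)[OF gr Diff_subset s', folded E2_def]
  obtain p where p: "set_pmf p \<subseteq> {M. perfect_matching ?i1 (insert t S) E1 M}"
    "\<forall>f\<in>E1. measure_pmf.prob p {M. f \<in> M} = x f"
    using h1 by (auto simp: pm_hull_def)
  obtain q where q: "set_pmf q \<subseteq> {M. perfect_matching ?i2 (insert s (V - S)) E2 M}"
    "\<forall>f\<in>E2. measure_pmf.prob q {M. f \<in> M} = x f"
    using h2 by (auto simp: pm_hull_def)
  have pC: "\<exists>e. M \<inter> C = {e}" "M \<subseteq> E1" if "M \<in> set_pmf p" for M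
  proof -
    have pm: "perfect_matching ?i1 (insert t S) E1 M" using p(1) that by blast
    then show "M \<subseteq> E1" by (simp add: perfect_matching_def)
    moreover obtain e where "M \<inter> cut ?i1 {t} = {e}" using perfect_matching_card_cut[OF pm, of t] by blast
    ultimately show "\<exists>e. M \<inter> C = {e}" using star1 by (intro exI[of _ e]) blast
  qed
  have qC: "\<exists>e. M \<inter> C = {e}" "M \<subseteq> E2" if "M \<in> set_pmf q" for M
  proof -
    have pm: "perfect_matching ?i2 (insert s (V - S)) E2 M" using q(1) that by blast
    then show "M \<subseteq> E2" by (simp add: perfect_matching_def)
    moreover obtain e where "M \<inter> cut ?i2 {s} = {e}" using perfect_matching_card_cut[OF pm, of s] by blast
    ultimately show "\<exists>e. M \<inter> C = {e}" using star2 by (intro exI[of _ e]) blast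
  qed
  have pe: "measure_pmf.prob p {M. M \<inter> C = {e}} = x e" if "e \<in> C" for e
  proof -
    have "measure_pmf.prob p {M. M \<inter> C = {e}} = measure_pmf.prob p {M. e \<in> M}"
    proof (intro measure_pmf.finite_measure_eq_AE)
      have "M \<inter> C = {e} \<longleftrightarrow> e \<in> M" if M: "M \<in> set_pmf p" for M
        using pC(1)[OF M] \<open>e \<in> C\<close> by (metis Int_iff singletonD singletonI)
      then show "AE M in measure_pmf p. (M \<in> {M. M \<inter> C = {e}}) = (M \<in> {M. e \<in> M})"
        by (simp add: AE_measure_pmf_iff)
    qed simp_all
    then show ?thesis using p(2) that C12 by auto
  qed
  have qe: "measure_pmf.prob q {M. M \<inter> C = {e}} = x e" if "e \<in> C" for e
  proof -
    have "measure_pmf.prob q {M. M \<inter> C = {e}} = measure_pmf.prob q {M. e \<in> M}"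
    proof (intro measure_pmf.finite_measure_eq_AE)
      have "M \<inter> C = {e} \<longleftrightarrow> e \<in> M" if M: "M \<in> set_pmf q" for M
        using qC(1)[OF M] \<open>e \<in> C\<close> by (metis Int_iff singletonD singletonI)
      then show "AE M in measure_pmf q. (M \<in> {M. M \<inter> C = {e}}) = (M \<in> {M. e \<in> M})"
        by (simp add: AE_measure_pmf_iff)
    qed simp_all
    then show ?thesis using q(2) that C12 by auto
  qed
  define R where "R M N \<longleftrightarrow> M \<inter> C = N \<inter> C" for M N
  have nz: "set_pmf q \<inter> {N. R M N} \<noteq> {}" if M: "M \<in> set_pmf p" for M
  proof -
    obtain e where e: "M \<inter> C = {e}" using pC(1)[OF M] by blast
    then have "e \<in> C" by blast
    have "measure_pmf.prob p {M. M \<inter> C = {e}} \<noteq> 0"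
      using M e by (auto simp: measure_pmf_zero_iff)
    then have "measure_pmf.prob q {M. M \<inter> C = {e}} \<noteq> 0" using pe[of e] qe[of e] \<open>e \<in> C\<close> by simp
    then show ?thesis using e by (auto simp: measure_pmf_zero_iff R_def)
  qed
  have nz': "set_pmf p \<inter> {M. R M N} \<noteq> {}" if N: "N \<in> set_pmf q" for N
  proof -
    obtain e where e: "N \<inter> C = {e}" using qC(1)[OF N] by blast
    then have "e \<in> C" by blast
    have "measure_pmf.prob q {M. M \<inter> C = {e}} \<noteq> 0"
      using N e by (auto simp: measure_pmf_zero_iff)
    then have "measure_pmf.prob p {M. M \<inter> C = {e}} \<noteq> 0" using pe[of e] qe[of e] \<open>e \<in> C\<close> by simp
    then show ?thesis using e by (auto simp: measure_pmf_zero_iff R_def)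
  qed
  \<comment> \<open>Averaged over \<open>M\<close>, the conditioned draw has law \<open>q\<close>
    again, since \<open>p\<close> and \<open>q\<close> give the same probability to each trace on
    \<open>C\<close>.\<close>
  have cancel: "p \<bind> (\<lambda>M. cond_pmf q {N. R M N}) = q"
  proof (rule bind_cond_pmf_cancel)
    fix M N assume MN: "M \<in> set_pmf p" "N \<in> set_pmf q" "R M N"
    obtain e where e: "M \<inter> C = {e}" using pC(1)[OF MN(1)] by blast
    then have "e \<in> C" "N \<inter> C = {e}" using MN(3) by (auto simp: R_def)
    then show "measure_pmf.prob q {N. R M N} = measure_pmf.prob p {M. R M N}"
      using e pe[of e] qe[of e] by (simp add: R_def eq_commute)
  qed (use nz nz' in auto)
  define m where "m = p \<bind> (\<lambda>M. map_pmf (\<lambda>N. M \<union> N) (cond_pmf q {N. R M N}))"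
  have setm: "\<exists>M\<in>set_pmf p. \<exists>N\<in>set_pmf q. M \<inter> C = N \<inter> C \<and> A = M \<union> N" if "A \<in> set_pmf m" for A
    using that nz by (auto simp: m_def set_cond_pmf R_def)
  \<comment> \<open>The union determines both halves: \<open>E1\<close> and \<open>E2\<close>
    overlap only in \<open>C\<close>, where \<open>M\<close> and \<open>N\<close> agree.\<close>
  have E1int: "(M \<union> N) \<inter> E1 = M" "(M \<union> N) \<inter> E2 = N"
    if "M \<in> set_pmf p" "N \<in> set_pmf q" "M \<inter> C = N \<inter> C" for M N
    using pC(2)[OF that(1)] qC(2)[OF that(2)] that(3) C12 by auto
  have "perfect_matching inc V E A" if A: "A \<in> set_pmf m" for A
  proof -
    obtain M N where MN: "M \<in> set_pmf p" "N \<in> set_pmf q" "M \<inter> C = N \<inter> C" "A = M \<union> N"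
      using setm[OF A] by blast
    have sub: "A \<subseteq> E" using MN pC(2) qC(2) E12 by blast
    have "card (A \<inter> cut inc {v}) = 1" if v: "v \<in> V" for v
    proof (cases "v \<in> S")
      case True
      have "A \<inter> cut inc {v} = A \<inter> (E1 \<inter> cut ?i1 {v})" using v1[OF True] sub by blast
      also have "\<dots> = M \<inter> cut ?i1 {v}" using E1int(1)[OF MN(1,2,3)] MN(4) by blast
      finally show ?thesis using p(1) MN(1) True by (auto simp: perfect_matching_def)
    next
      case False
      have "A \<inter> cut inc {v} = A \<inter> (E2 \<inter> cut ?i2 {v})" using v2 False v sub by blast
      also have "\<dots> = N \<inter> cut ?i2 {v}" using E1int(2)[OF MN(1,2,3)] MN(4) by blast
      finally show ?thesis using q(1) MN(2) v False by (auto simp: perfect_matching_def)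
    qed
    then show ?thesis using sub by (simp add: perfect_matching_def)
  qed
  moreover have "measure_pmf.prob m {M. f \<in> M} = x f" if f: "f \<in> E" for f
  proof -
    have m1: "map_pmf (\<lambda>A. A \<inter> E1) m = p"
    proof -
      have "map_pmf (\<lambda>A. A \<inter> E1) m
          = p \<bind> (\<lambda>M. map_pmf (\<lambda>N. (M \<union> N) \<inter> E1) (cond_pmf q {N. R M N}))"
        by (simp add: m_def map_bind_pmf pmf.map_comp o_def)
      also have "\<dots> = p \<bind> (\<lambda>M. map_pmf (\<lambda>N. M) (cond_pmf q {N. R M N}))"
        using nz E1int by (intro bind_pmf_cong refl map_pmf_cong) (auto simp: set_cond_pmf R_def)
      finally show ?thesis by (simp add: bind_return_pmf')
    qed
    have m2: "map_pmf (\<lambda>A. A \<inter> E2) m = q"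
    proof -
      have "map_pmf (\<lambda>A. A \<inter> E2) m
          = p \<bind> (\<lambda>M. map_pmf (\<lambda>N. (M \<union> N) \<inter> E2) (cond_pmf q {N. R M N}))"
        by (simp add: m_def map_bind_pmf pmf.map_comp o_def)
      also have "\<dots> = p \<bind> (\<lambda>M. map_pmf (\<lambda>N. N) (cond_pmf q {N. R M N}))"
        using nz E1int by (intro bind_pmf_cong refl map_pmf_cong) (auto simp: set_cond_pmf R_def)
      finally show ?thesis using cancel by simp
    qed
    show ?thesis
    proof (cases "f \<in> E1")
      case True
      have "measure_pmf.prob p {M. f \<in> M} = measure_pmf.prob m {M. f \<in> M}"
        unfolding m1[symmetric] using True by (simp add: vimage_def)
      then show ?thesis using True p(2) by simp
    next
      case False
      then have "f \<in> E2" using f E12 by blast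
      have "measure_pmf.prob q {M. f \<in> M} = measure_pmf.prob m {M. f \<in> M}"
        unfolding m2[symmetric] using \<open>f \<in> E2\<close> by (simp add: vimage_def)
      then show ?thesis using \<open>f \<in> E2\<close> q(2) by simp
    qed
  qed
  ultimately show ?thesis unfolding pm_hull_def by blast
qed

section \<open>Kernel directions and the way to the boundary\<close>

text \<open>Gaussian elimination by induction on the equations: equation \<open>b\<close> is solved
  for an unknown \<open>a0\<close> with nonzero coefficient, which is substituted into the
  others.\<close>

lemma exists_kernel_vector:
  fixes c :: "'b \<Rightarrow> 'a \<Rightarrow> real"
  assumes "finite B" "finite A" "card B < card A"
  shows "\<exists>z. (\<exists>a\<in>A. z a \<noteq> 0) \<and> (\<forall>b\<in>B. (\<Sum>a\<in>A. c b a * z a) = 0)"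
  using assms
proof (induction B arbitrary: A c rule: finite_induct)
  case empty
  then obtain a where "a \<in> A" by (metis card.empty card_gt_0_iff ex_in_conv)
  then show ?case by (intro exI[of _ "\<lambda>_. 1"]) auto
next
  case (insert b B)
  show ?case
  proof (cases "\<exists>a\<in>A. c b a \<noteq> 0")
    case False
    obtain z where "\<exists>a\<in>A. z a \<noteq> 0" "\<forall>b\<in>B. (\<Sum>a\<in>A. c b a * z a) = 0"
      using insert.IH[of A c] insert.prems insert.hyps by auto
    then show ?thesis using False by (intro exI[of _ z]) auto
  next
    case True
    then obtain a0 where a0: "a0 \<in> A" "c b a0 \<noteq> 0" by blast
    define c' where "c' b' a = c b' a - c b' a0 * c b a / c b a0" for b' a
    have "card B < card (A - {a0})" using insert.prems insert.hyps a0 by auto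
    then obtain z' where z': "\<exists>a\<in>A - {a0}. z' a \<noteq> 0" "\<forall>b'\<in>B. (\<Sum>a\<in>A - {a0}. c' b' a * z' a) = 0"
      using insert.IH[of "A - {a0}" c'] insert.prems by auto
    define s where "s = (\<Sum>a\<in>A - {a0}. c b a * z' a)"
    define z where "z a = (if a = a0 then - s / c b a0 else z' a)" for a
    have split: "(\<Sum>a\<in>A. c b' a * z a) = - c b' a0 * s / c b a0 + (\<Sum>a\<in>A - {a0}. c b' a * z' a)" for b'
      using a0 insert.prems(1) by (simp add: sum.remove z_def)
    have "(\<Sum>a\<in>A. c b' a * z a) = 0" if "b' \<in> B" for b'
    proof -
      have "(\<Sum>a\<in>A - {a0}. c' b' a * z' a)
          = (\<Sum>a\<in>A - {a0}. c b' a * z' a) - (\<Sum>a\<in>A - {a0}. (c b' a0 / c b a0) * (c b a * z' a))"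
        unfolding sum_subtractf[symmetric] by (intro sum.cong refl) (simp add: c'_def algebra_simps)
      then have "0 = (\<Sum>a\<in>A - {a0}. c b' a * z' a) - (c b' a0 / c b a0) * s"
        using z'(2) that by (simp add: s_def sum_distrib_left)
      then show ?thesis unfolding split by simp
    qed
    moreover have "(\<Sum>a\<in>A. c b a * z a) = 0" using a0(2) unfolding split by (simp add: s_def)
    moreover have "\<exists>a\<in>A. z a \<noteq> 0" using z'(1) by (auto simp: z_def)
    ultimately show ?thesis by (intro exI[of _ z]) auto
  qed
qed

text \<open>The ratio test of the simplex method. A pair holds the current slack \<open>g\<close> of
  a constraint and its rate of change \<open>h\<close> along the ray; the smallest ratio
  \<open>g / - h\<close> over the decreasing constraints is the first time at which one of them
  becomes tight.\<close>

lemma ray_hits_boundary: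
  fixes G :: "(real \<times> real) set"
  assumes "finite G" "\<forall>(g, h)\<in>G. 0 < g" "\<exists>(g, h)\<in>G. h < 0"
  shows "\<exists>t>0. (\<forall>(g, h)\<in>G. 0 \<le> g + t * h) \<and> (\<exists>(g, h)\<in>G. g + t * h = 0)"
proof -
  define T where "T = (\<lambda>(g, h). g / - h) ` {p \<in> G. snd p < 0}"
  have T: "finite T" "T \<noteq> {}" using assms(1,3) by (auto simp: T_def)
  define t where "t = Min T"
  have "t \<in> T" using T by (simp add: t_def)
  then obtain g h where gh: "(g, h) \<in> G" "h < 0" "t = g / - h" by (auto simp: T_def)
  have "0 < t" using gh assms(2) by (auto simp: divide_pos_neg)
  moreover have "g + t * h = 0" using gh by (simp add: field_simps)
  moreover have "0 \<le> g' + t * h'" if "(g', h') \<in> G" for g' h'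
  proof (cases "h' < 0")
    case True
    then have "t \<le> g' / - h'" using that T unfolding t_def by (intro Min_le) (auto simp: T_def)
    then show ?thesis using True by (simp add: field_simps)
  next
    case False
    then have "0 \<le> t * h'" using \<open>0 < t\<close> by simp
    moreover have "0 < g'" using that assms(2) by auto
    ultimately show ?thesis by simp
  qed
  ultimately show ?thesis using gh(1) by (intro exI[of _ t]) auto
qed

text \<open>These are the odd cuts that make progress: shrinking either side reduces the number of
  vertices. An odd cut with a single vertex on one side is merely a degree equation.\<close>

definition nontrivial_odd :: "'v set \<Rightarrow> 'v set \<Rightarrow> bool" where
  "nontrivial_odd V S \<longleftrightarrow> S \<subseteq> V \<and> odd (card S) \<and> 3 \<le> card S \<and> 3 \<le> card (V - S)"

lemma nontrivial_odd_complement: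
  assumes "edmonds inc V E x" "nontrivial_odd V S"
  shows "nontrivial_odd V (V - S)"
proof -
  have "finite V" using assms by (simp add: edmonds_def graph_def)
  then show ?thesis
    using edmonds_even[OF assms(1)] assms(2) card_mono[of V S]
    by (auto simp: nontrivial_odd_def card_Diff_subset finite_subset double_diff)
qed

text \<open>Cuts around one vertex, seen from either side, are degree equations and persist because
  \<open>z\<close> sums to 0 at every vertex. What remains to be supplied is nonnegativity and the
  nontrivial odd cuts.\<close>

lemma edmonds_shift:
  assumes ed: "edmonds inc V E x" and z: "\<forall>v\<in>V. sum z (E \<inter> cut inc {v}) = 0"
    and nn: "\<forall>e\<in>E. 0 \<le> x e + t * z e"
    and oc: "\<forall>U. nontrivial_odd V U \<longrightarrow> 1 \<le> sum x (E \<inter> cut inc U) + t * sum z (E \<inter> cut inc U)"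
  shows "edmonds inc V E (\<lambda>e. x e + t * z e)"
proof -
  have gr: "graph inc V E" and fin: "finite V" using ed by (auto simp: edmonds_def graph_def)
  have sum: "(\<Sum>e\<in>A. x e + t * z e) = sum x A + t * sum z A" for A
    by (simp add: sum.distrib sum_distrib_left)
  have one: "(\<Sum>e\<in>E \<inter> cut inc {v}. x e + t * z e) = 1" if "v \<in> V" for v
    using ed z that unfolding sum by (simp add: edmonds_def)
  have "1 \<le> (\<Sum>e\<in>E \<inter> cut inc U. x e + t * z e)" if U: "U \<subseteq> V" "odd (card U)" for U
  proof (cases "nontrivial_odd V U")
    case True
    then show ?thesis using oc unfolding sum by blast
  next
    case False
    have "card (V - U) = card V - card U" "card U \<le> card V"
      using U fin by (auto simp: card_Diff_subset finite_subset card_mono)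
    then have "odd (card (V - U))" using U(2) edmonds_even[OF ed] by simp
    moreover have "k = 1 \<or> 3 \<le> k" if "odd k" for k :: nat using that by presburger
    ultimately have "card U = 1 \<or> card (V - U) = 1"
      using False U unfolding nontrivial_odd_def by blast
    then show ?thesis
    proof
      assume "card U = 1"
      then obtain v where "U = {v}" by (rule card_1_singletonE)
      then show ?thesis using one U(1) by simp
    next
      assume "card (V - U) = 1"
      then obtain v where "V - U = {v}" by (rule card_1_singletonE)
      then have "v \<in> V" "E \<inter> cut inc U = E \<inter> cut inc {v}"
        using cut_complement[OF gr, of U] by auto
      then show ?thesis using one[of v] by simp
    qed
  qed
  then show ?thesis using gr one nn by (simp add: edmonds_def)
qed

text \<open>A nonnegative kernel vector would vanish on every star. So moving along a nonzero kernel
  vector decreases some coordinate and must reach the boundary.\<close>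

lemma kernel_has_negative:
  fixes z :: "'e \<Rightarrow> real"
  assumes gr: "graph inc V E" and z: "\<forall>v\<in>V. sum z (E \<inter> cut inc {v}) = 0" "e \<in> E" "z e \<noteq> 0"
  shows "\<exists>f\<in>E. z f < 0"
proof (rule ccontr)
  assume "\<not> ?thesis"
  then have nn: "0 \<le> z f" if "f \<in> E" for f using that by force
  obtain u v where uv: "inc e = {u, v}" "u \<in> V" using graphD[OF gr z(2)] .
  have "e \<in> E \<inter> cut inc {u}" using cut_single[OF gr z(2)] uv z(2) by simp
  moreover have "finite (E \<inter> cut inc {u})" using gr by (simp add: graph_def)
  ultimately have "z e = 0"
    using z(1) uv(2) nn sum_nonneg_eq_0_iff[of "E \<inter> cut inc {u}" z] by auto
  then show False using z(3) by simp
qed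

text \<open>A vertex of degree 2 together with its two neighbours forms a tight odd set, hence can only
  occur in a 4-cycle; if all degrees other than 1 are at least 3, there are more edges than
  equations.\<close>
lemma exists_kernel_direction:
  assumes ed: "edmonds inc V E x" and pos: "\<forall>e\<in>E. 0 < x e"
    and strict: "\<forall>U. nontrivial_odd V U \<longrightarrow> 1 < sum x (E \<inter> cut inc U)"
    and deg: "v0 \<in> V" "card (E \<inter> cut inc {v0}) \<noteq> 1"
  shows "\<exists>z::'e \<Rightarrow> real. (\<forall>v\<in>V. sum z (E \<inter> cut inc {v}) = 0) \<and> (\<exists>e\<in>E. z e \<noteq> 0)"
proof -
  have gr: "graph inc V E" and fin: "finite V" "finite E" using ed by (auto simp: edmonds_def graph_def)
  have one: "sum x (E \<inter> cut inc {v}) = 1" if "v \<in> V" for v using ed that by (simp add: edmonds_def)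
  have cs: "e \<in> cut inc {v} \<longleftrightarrow> v \<in> inc e" if "e \<in> E" for e v using cut_single[OF gr that] .
  have deg0: "card (E \<inter> cut inc {v}) \<noteq> 0" if "v \<in> V" for v
  proof
    assume "card (E \<inter> cut inc {v}) = 0"
    then have "E \<inter> cut inc {v} = {}" using fin by simp
    then show False using one[OF that] by simp
  qed
  show ?thesis
  proof (cases "\<exists>e\<in>E. \<exists>f\<in>E. e \<noteq> f \<and> inc e = inc f")
    case True
    then obtain e f where ef: "e \<in> E" "f \<in> E" "e \<noteq> f" "inc e = inc f" by blast
    \<comment> \<open>Shifting weight from one of two parallel edges to the other leaves every
      degree sum unchanged.\<close>
    define z :: "'e \<Rightarrow> real" where "z g = (if g = e then 1 else if g = f then - 1 else 0)" for g
    have "sum z (E \<inter> cut inc {v}) = 0" for v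
    proof (cases "v \<in> inc e")
      case True
      then have "sum z (E \<inter> cut inc {v}) = sum z {e, f}"
        using ef cs fin by (intro sum.mono_neutral_right) (auto simp: z_def)
      then show ?thesis using ef by (simp add: z_def)
    next
      case False
      then show ?thesis using ef cs by (intro sum.neutral) (auto simp: z_def)
    qed
    moreover have "z e \<noteq> 0" by (simp add: z_def)
    ultimately show ?thesis using ef(1) by blast
  next
    case False
    then have simple: "e = f" if "e \<in> E" "f \<in> E" "inc e = inc f" for e f using that by blast
    show ?thesis
    proof (cases "\<exists>v\<in>V. card (E \<inter> cut inc {v}) = 2")
      case True
      then obtain v where v: "v \<in> V" "card (E \<inter> cut inc {v}) = 2" by blast
      then obtain e g where eg: "E \<inter> cut inc {v} = {e, g}" "e \<noteq> g" by (meson card_2_iff)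
      then have egE: "e \<in> E" "g \<in> E" and "v \<in> inc e" "v \<in> inc g" using cs by auto
      obtain u where u: "inc e = {v, u}" "u \<noteq> v" "u \<in> V"
        using graph_other_end[OF gr egE(1) \<open>v \<in> inc e\<close>] .
      obtain w where w: "inc g = {v, w}" "w \<noteq> v" "w \<in> V"
        using graph_other_end[OF gr egE(2) \<open>v \<in> inc g\<close>] .
      have "u \<noteq> w" using simple egE eg(2) u w by auto
      define S where "S = {u, v, w}"
      have S: "S \<subseteq> V" "card S = 3" using u w v \<open>u \<noteq> w\<close> by (auto simp: S_def)
      define I where "I = {f \<in> E. inc f \<subseteq> S}"
      have ind: "sum x (E \<inter> A) = (\<Sum>f\<in>E. if f \<in> A then x f else 0)" for A
        using fin by (simp add: sum.inter_restrict)
      \<comment> \<open>Adding the degree equations at \<open>u\<close>, \<open>v\<close> and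
        \<open>w\<close> gives x(cut S) + 2 x(I) = 3. As \<open>e\<close> and \<open>g\<close>
        already contribute 1 to x(I) and the cut has at least 1, the cut is tight and
        \<open>I\<close> is exactly \<open>{e, g}\<close>.\<close>
      have count: "(if f \<in> cut inc {u} then x f else 0) + (if f \<in> cut inc {v} then x f else 0)
          + (if f \<in> cut inc {w} then x f else 0)
          = (if f \<in> cut inc S then x f else 0) + 2 * (if f \<in> I then x f else 0)" if f: "f \<in> E" for f
      proof -
        obtain a b where "inc f = {a, b}" "a \<noteq> b" using graphD[OF gr f] .
        then show ?thesis using f cs[OF f] u(2) w(2) \<open>u \<noteq> w\<close>
          by (auto simp: S_def I_def cut_def)
      qed
      have "sum x (E \<inter> cut inc {u}) + sum x (E \<inter> cut inc {v}) + sum x (E \<inter> cut inc {w})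
          = sum x (E \<inter> cut inc S) + 2 * sum x (E \<inter> I)"
        unfolding ind sum_distrib_left sum.distrib[symmetric] using count by (intro sum.cong) auto
      then have three: "sum x (E \<inter> cut inc S) + 2 * sum x I = 3"
        using one u(3) v(1) w(3) by (simp add: I_def Int_absorb1 Collect_conj_eq flip: Int_assoc)
      have egI: "{e, g} \<subseteq> I" "finite I" using egE u w fin by (auto simp: I_def S_def)
      have eg1: "x e + x g = 1" using one[OF v(1)] eg by simp
      have "1 \<le> sum x (E \<inter> cut inc S)" using ed S by (simp add: edmonds_def)
      have I1: "sum x I = 1 + sum x (I - {e, g})"
        using egI eg(2) eg1 by (simp add: sum.subset_diff[OF egI])
      have Ipos: "0 < x f" if "f \<in> I" for f using that pos by (simp add: I_def)
      have "sum x (I - {e, g}) = 0" "sum x (E \<inter> cut inc S) = 1"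
        using three I1 \<open>1 \<le> sum x (E \<inter> cut inc S)\<close> sum_nonneg[of "I - {e, g}" x] Ipos
        by (auto simp: less_imp_le)
      have Ieg: "I = {e, g}"
      proof (rule ccontr)
        assume "I \<noteq> {e, g}"
        then have "I - {e, g} \<noteq> {}" using egI by blast
        then have "0 < sum x (I - {e, g})" using egI Ipos by (intro sum_pos) auto
        then show False using \<open>sum x (I - {e, g}) = 0\<close> by simp
      qed
      have "card (V - S) = card V - 3" "3 \<le> card V"
        using S fin card_mono[OF fin(1) S(1)] by (auto simp: card_Diff_subset finite_subset)
      moreover have "\<not> nontrivial_odd V S" using strict \<open>sum x (E \<inter> cut inc S) = 1\<close> by auto
      ultimately have "card (V - S) = 1"
        using S edmonds_even[OF ed] by (auto simp: nontrivial_odd_def) presburger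
      then obtain t where t: "V - S = {t}" by (rule card_1_singletonE)
      then have tV: "V = {u, v, w, t}" "t \<notin> {u, v, w}" using S(1) by (auto simp: S_def)
      \<comment> \<open>Since \<open>x k < 1\<close>, the vertex \<open>a\<close> has a second edge;
        it cannot stay inside \<open>S\<close>, whose only edges are \<open>e\<close> and
        \<open>g\<close>, and so it leads to \<open>t\<close>.\<close>
      have other: "\<exists>h\<in>E. inc h = {a, t}" if a: "a \<in> {u, w}" and k: "k \<in> {e, g}" "a \<in> inc k" for a k
      proof -
        have kE: "k \<in> E \<inter> cut inc {a}" using k egE cs by auto
        have "x k < 1" using k eg1 pos egE by force
        moreover have "sum x (E \<inter> cut inc {a}) = 1" using one a u(3) w(3) by auto
        ultimately have "E \<inter> cut inc {a} \<noteq> {k}" by auto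
        then obtain h where h: "h \<in> E" "h \<noteq> k" "a \<in> inc h" using kE cs by auto
        obtain b where b: "inc h = {a, b}" "b \<noteq> a" "b \<in> V" using graph_other_end[OF gr h(1,3)] .
        have "h \<notin> {e, g}" using h(2,3) k a u w \<open>u \<noteq> w\<close> by auto
        then have "h \<notin> I" using Ieg by simp
        then have "b \<notin> {u, v, w}" using b a h(1) by (auto simp: I_def S_def)
        then show ?thesis using b tV h(1) by auto
      qed
      obtain h where h: "h \<in> E" "inc h = {u, t}" using other[of u e] u by auto
      obtain l where l: "l \<in> E" "inc l = {w, t}" using other[of w g] w by auto
      have all: "f \<in> {e, g, h, l}" if f: "f \<in> E" for f
      proof -
        obtain a b where ab: "inc f = {a, b}" "a \<noteq> b" "a \<in> V" "b \<in> V" using graphD[OF gr f] .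
        show ?thesis
        proof (cases "t \<in> inc f")
          case False
          then have "f \<in> I" using ab tV f by (auto simp: I_def S_def)
          then show ?thesis using Ieg by blast
        next
          case True
          then have "inc f = {u, t} \<or> inc f = {w, t} \<or> inc f = {v, t}" using ab tV by auto
          moreover have "inc f \<noteq> {v, t}"
          proof
            assume eq: "inc f = {v, t}"
            then have "f \<in> {e, g}" using f cs eg(1) by auto
            then show False using eq u w tV(2) by auto
          qed
          ultimately show ?thesis using simple[OF f h(1)] simple[OF f l(1)] h(2) l(2) by auto
        qed
      qed
      have dist: "h \<noteq> e" "h \<noteq> g" "l \<noteq> e" "l \<noteq> g" "h \<noteq> l"
        using h(2) l(2) u(1,2) w(1,2) \<open>u \<noteq> w\<close> tV(2) by auto
      have E4: "E = {e, g, h, l}" using all egE h(1) l(1) by auto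
      \<comment> \<open>Alternating signs around the 4-cycle \<open>v\<close>, \<open>u\<close>,
        \<open>t\<close>, \<open>w\<close> with edges \<open>e\<close>, \<open>h\<close>,
        \<open>l\<close>, \<open>g\<close>.\<close>
      define z :: "'e \<Rightarrow> real" where "z f = (if f = e \<or> f = l then 1 else - 1)" for f
      have "E \<inter> cut inc {u} = {e, h}" "E \<inter> cut inc {w} = {g, l}" "E \<inter> cut inc {t} = {h, l}"
        using cs E4 u(1,2) w(1,2) h(2) l(2) tV(2) \<open>u \<noteq> w\<close> by auto
      then have "\<forall>v\<in>V. sum z (E \<inter> cut inc {v}) = 0"
        using tV(1) eg dist by (auto simp: z_def)
      moreover have "z e \<noteq> 0" by (simp add: z_def)
      ultimately show ?thesis using egE(1) by blast
    next
      case False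
      \<comment> \<open>Vertices of degree 1 are set aside: their only edge has weight 1 and is then
        the only edge at its other end as well. Hence the edges in \<open>F\<close> stay inside
        \<open>X\<close>, and degrees of at least 3 give 3 |X| <= 2 |F|, so there are more unknowns
        than equations.\<close>
      define X where "X = {v \<in> V. card (E \<inter> cut inc {v}) \<noteq> 1}"
      define F where "F = {e \<in> E. inc e \<inter> X \<noteq> {}}"
      have finX: "finite X" "finite F" using fin by (auto simp: X_def F_def)
      have "v0 \<in> X" using deg by (simp add: X_def)
      have deg3: "3 \<le> card (E \<inter> cut inc {v})" if "v \<in> X" for v
      proof -
        have "card (E \<inter> cut inc {v}) \<notin> {0, 1, 2}" using that False deg0 by (auto simp: X_def)
        then show ?thesis by simp
      qed
      have FX: "inc e \<subseteq> X" if e: "e \<in> F" for e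
      proof (rule ccontr)
        assume "\<not> inc e \<subseteq> X"
        then obtain v w where vw: "v \<in> X" "w \<notin> X" "v \<in> inc e" "w \<in> inc e" using e by (auto simp: F_def)
        have "e \<in> E" using e by (simp add: F_def)
        have "inc e \<subseteq> V" using gr \<open>e \<in> E\<close> by (simp add: graph_def)
        then have "card (E \<inter> cut inc {w}) = 1" "w \<in> V" using vw by (auto simp: X_def)
        moreover have "e \<in> E \<inter> cut inc {w}" using cs \<open>e \<in> E\<close> vw by simp
        ultimately have "E \<inter> cut inc {w} = {e}" by (metis card_1_singletonE singletonD)
        then have "x e = 1" using one[OF \<open>w \<in> V\<close>] by simp
        have ev: "e \<in> E \<inter> cut inc {v}" using cs \<open>e \<in> E\<close> vw by simp
        have "v \<in> V" using vw by (simp add: X_def)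
        then have "sum x (E \<inter> cut inc {v} - {e}) = 0"
          using one[of v] ev \<open>x e = 1\<close> fin by (simp add: sum_diff1)
        moreover have "0 < sum x (E \<inter> cut inc {v} - {e})" if "E \<inter> cut inc {v} - {e} \<noteq> {}"
          using that fin pos by (intro sum_pos) auto
        ultimately have "E \<inter> cut inc {v} = {e}" using ev by force
        then show False using deg3[OF vw(1)] by simp
      qed
      have Fcut: "F \<inter> cut inc {v} = E \<inter> cut inc {v}" if "v \<in> X" for v
        using cs that by (auto simp: F_def)
      have "3 * card X \<le> (\<Sum>v\<in>X. card (F \<inter> cut inc {v}))"
        using sum_mono[of X "\<lambda>_. 3" "\<lambda>v. card (F \<inter> cut inc {v})"] deg3 Fcut by (simp add: mult.commute)
      also have "\<dots> = (\<Sum>v\<in>X. \<Sum>e\<in>F. if v \<in> inc e then 1 else 0)"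
      proof (intro sum.cong refl)
        fix v
        have "F \<inter> cut inc {v} = {e \<in> F. v \<in> inc e}" using cs by (auto simp: F_def)
        then show "card (F \<inter> cut inc {v}) = (\<Sum>e\<in>F. if v \<in> inc e then 1 else 0)"
          using finX by (simp add: sum.If_cases Collect_conj_eq)
      qed
      also have "\<dots> = (\<Sum>e\<in>F. \<Sum>v\<in>X. if v \<in> inc e then 1 else 0)" by (rule sum.swap)
      also have "\<dots> = (\<Sum>e\<in>F. 2)"
      proof (intro sum.cong refl)
        fix e assume e: "e \<in> F"
        have "X \<inter> {v. v \<in> inc e} = inc e" using FX[OF e] by blast
        moreover have "card (inc e) = 2" using gr e by (simp add: graph_def F_def)
        ultimately show "(\<Sum>v\<in>X. if v \<in> inc e then 1 else 0) = (2::nat)"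
          using finX by (simp add: sum.If_cases)
      qed
      finally have "3 * card X \<le> 2 * card F" by simp
      moreover have "0 < card X" using \<open>v0 \<in> X\<close> finX by (auto simp: card_gt_0_iff)
      ultimately have "card X < card F" by linarith
      then obtain z' where z': "\<exists>e\<in>F. z' e \<noteq> 0"
        "\<forall>v\<in>X. (\<Sum>e\<in>F. (if e \<in> cut inc {v} then 1 else 0) * z' e) = (0::real)"
        using exists_kernel_vector[OF finX, of "\<lambda>v e. if e \<in> cut inc {v} then 1 else 0"] by blast
      define z where "z e = (if e \<in> F then z' e else 0)" for e
      have "sum z (E \<inter> cut inc {v}) = 0" if v: "v \<in> V" for v
      proof (cases "v \<in> X")
        case True
        have "sum z (E \<inter> cut inc {v}) = sum z' (F \<inter> cut inc {v})"
          unfolding Fcut[OF True, symmetric] by (intro sum.cong) (auto simp: z_def)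
        also have "\<dots> = (\<Sum>e\<in>F. (if e \<in> cut inc {v} then 1 else 0) * z' e)"
          unfolding sum.inter_restrict[OF finX(2)] by (intro sum.cong) auto
        finally show ?thesis using z'(2) True by simp
      next
        case False
        have "z e = 0" if "e \<in> E \<inter> cut inc {v}" for e
          using that False FX[of e] cs[of e v] by (auto simp: z_def)
        then show ?thesis by simp
      qed
      moreover have "\<exists>e\<in>E. z e \<noteq> 0" using z'(1) by (auto simp: z_def F_def)
      ultimately show ?thesis by blast
    qed
  qed
qed

text \<open>Moving from x in both directions along a kernel vector of the degree equations, one reaches
  points where an edge vanishes, which is deleted, or where a nontrivial odd cut is tight, whose
  two sides are contracted in turn.\<close>
theorem edmonds_imp_pm_hull:
  assumes "edmonds inc V E x"
  shows "pm_hull inc V E x"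
  using assms
proof (induction "card V + card E" arbitrary: inc V E x rule: less_induct)
  case less
  note ed = less.prems
  have gr: "graph inc V E" and fin: "finite V" "finite E" using ed by (auto simp: edmonds_def graph_def)
  \<comment> \<open>Stated for any feasible \<open>y\<close> on the same graph, since it serves both
    for \<open>x\<close> itself and for the points reached from it.\<close>
  have boundary: "pm_hull inc V E y"
    if y: "edmonds inc V E y" and bd: "(\<exists>e\<in>E. y e = 0) \<or> (\<exists>S. nontrivial_odd V S \<and> sum y (E \<inter> cut inc S) = 1)" for y
    using bd
  proof
    assume "\<exists>e\<in>E. y e = 0"
    then obtain e where e: "e \<in> E" "y e = 0" by blast
    have "card (E - {e}) < card E" using e fin by (meson card_Diff1_less)
    then have "pm_hull inc V (E - {e}) y"
      using less.hyps[OF _ edmonds_delete[OF y e(2)]] by simp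
    then show ?thesis using e(2) by (rule pm_hull_delete)
  next
    assume "\<exists>S. nontrivial_odd V S \<and> sum y (E \<inter> cut inc S) = 1"
    then obtain S where S: "nontrivial_odd V S" "sum y (E \<inter> cut inc S) = 1" by blast
    have S': "S \<subseteq> V" "odd (card S)" "nontrivial_odd V (V - S)"
      using S(1) nontrivial_odd_complement[OF y S(1)] by (auto simp: nontrivial_odd_def)
    have tight': "sum y (E \<inter> cut inc (V - S)) = 1" using S(2) cut_complement[OF gr] by simp
    have VV: "V - (V - S) = S" using S'(1) by blast
    have "S \<noteq> {}" "V - S \<noteq> {}" using S(1) by (auto simp: nontrivial_odd_def)
    then obtain s t where st: "s \<in> S" "t \<in> V - S" by blast
    have finS: "finite S" using S'(1) fin finite_subset by blast
    have cards: "card V = card S + card (V - S)"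
      using S'(1) fin finS by (simp add: card_Diff_subset card_mono)
    have le: "card {e \<in> E. inc e \<inter> A \<noteq> {}} \<le> card E" for A using fin by (intro card_mono) auto
    have 1: "card (insert t S) < card V" "card (insert s (V - S)) < card V"
      using cards S(1) S' st fin finS by (auto simp: nontrivial_odd_def)
    have "pm_hull (\<lambda>e. (\<lambda>v. if v \<in> S then v else t) ` inc e) (insert t S) {e \<in> E. inc e \<inter> S \<noteq> {}} y"
      using 1(1) le[of S]
      by (intro less.hyps edmonds_contract[OF y S'(1,2) st(2) S(2)]) linarith
    moreover have "pm_hull (\<lambda>e. (\<lambda>v. if v \<in> V - S then v else s) ` inc e) (insert s (V - S))
        {e \<in> E. inc e \<inter> (V - S) \<noteq> {}} y"
    proof (intro less.hyps edmonds_contract[OF y Diff_subset _ _ tight'])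
      show "odd (card (V - S))" using S'(3) by (simp add: nontrivial_odd_def)
      show "s \<in> V - (V - S)" using st(1) VV by simp
      show "card (insert s (V - S)) + card {e \<in> E. inc e \<inter> (V - S) \<noteq> {}} < card V + card E"
        using 1(2) le[of "V - S"] by linarith
    qed
    ultimately show ?thesis
      using pm_hull_glue[OF gr S'(1) st(2,1)] by blast
  qed
  show ?case
  proof (cases "(\<exists>e\<in>E. x e = 0) \<or> (\<exists>S. nontrivial_odd V S \<and> sum x (E \<inter> cut inc S) = 1)")
    case True
    then show ?thesis using boundary[OF ed] by blast
  next
    case False
    have pos: "0 < x e" if "e \<in> E" for e
    proof -
      have "0 \<le> x e" using ed that by (simp add: edmonds_def)
      moreover have "x e \<noteq> 0" using False that by blast
      ultimately show ?thesis by simp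
    qed
    have strict: "1 < sum x (E \<inter> cut inc U)" if "nontrivial_odd V U" for U
    proof -
      have "1 \<le> sum x (E \<inter> cut inc U)" using ed that by (simp add: edmonds_def nontrivial_odd_def)
      moreover have "sum x (E \<inter> cut inc U) \<noteq> 1" using False that by blast
      ultimately show ?thesis by simp
    qed
    have move: "\<exists>t>0. pm_hull inc V E (\<lambda>e. x e + t * z e)"
      if z: "\<forall>v\<in>V. sum z (E \<inter> cut inc {v}) = 0" "\<exists>e\<in>E. z e \<noteq> 0" for z
    proof -
      \<comment> \<open>Slack and rate of change of every nonnegativity and every nontrivial odd cut
        constraint.\<close>
      define G where "G = (\<lambda>e. (x e, z e)) ` E
        \<union> (\<lambda>U. (sum x (E \<inter> cut inc U) - 1, sum z (E \<inter> cut inc U))) ` {U. nontrivial_odd V U}"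
      have "finite {U. nontrivial_odd V U}"
        using fin by (auto simp: nontrivial_odd_def intro: finite_subset[of _ "Pow V"])
      then have G1: "finite G" using fin by (simp add: G_def)
      have G2: "\<forall>(g, h)\<in>G. 0 < g" using pos strict by (auto simp: G_def)
      have G3: "\<exists>(g, h)\<in>G. h < 0"
      proof -
        obtain e where "e \<in> E" "z e < 0" using kernel_has_negative[OF gr z(1)] z(2) by blast
        then have "(x e, z e) \<in> G" by (simp add: G_def)
        then show ?thesis using \<open>z e < 0\<close> by blast
      qed
      from ray_hits_boundary[OF G1 G2 G3]
      obtain t where t: "0 < t" "\<forall>(g, h)\<in>G. 0 \<le> g + t * h" "\<exists>(g, h)\<in>G. g + t * h = 0"
        by (elim exE conjE)
      have shifted: "edmonds inc V E (\<lambda>e. x e + t * z e)"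
      proof (intro edmonds_shift[OF ed z(1)] ballI allI impI)
        show "0 \<le> x e + t * z e" if "e \<in> E" for e using t(2) that by (simp add: G_def ball_Un)
        show "1 \<le> sum x (E \<inter> cut inc U) + t * sum z (E \<inter> cut inc U)" if U: "nontrivial_odd V U" for U
        proof -
          have "0 \<le> (sum x (E \<inter> cut inc U) - 1) + t * sum z (E \<inter> cut inc U)"
            using t(2) U by (simp add: G_def ball_Un)
          then show ?thesis by simp
        qed
      qed
      have sum: "(\<Sum>e\<in>A. x e + t * z e) = sum x A + t * sum z A" for A
        by (simp add: sum.distrib sum_distrib_left)
      have "(\<exists>e\<in>E. x e + t * z e = 0)
          \<or> (\<exists>S. nontrivial_odd V S \<and> (\<Sum>e\<in>E \<inter> cut inc S. x e + t * z e) = 1)"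
        using t(3) unfolding sum by (auto simp: G_def)
      then have "pm_hull inc V E (\<lambda>e. x e + t * z e)" by (rule boundary[OF shifted])
      then show ?thesis using t(1) by (intro exI[of _ t] conjI)
    qed
    show ?thesis
    proof (cases "\<exists>v\<in>V. card (E \<inter> cut inc {v}) \<noteq> 1")
      case True
      then obtain z where z: "\<forall>v\<in>V. sum z (E \<inter> cut inc {v}) = (0::real)" "\<exists>e\<in>E. z e \<noteq> 0"
        using exists_kernel_direction[OF ed] pos strict by blast
      from move[OF z] obtain t where t: "0 < t" "pm_hull inc V E (\<lambda>e. x e + t * z e)"
        by (elim exE conjE)
      have z': "\<forall>v\<in>V. sum (\<lambda>e. - z e) (E \<inter> cut inc {v}) = 0" "\<exists>e\<in>E. - z e \<noteq> 0"
        using z by (simp_all add: sum_negf)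
      from move[OF z'] obtain s where s: "0 < s" "pm_hull inc V E (\<lambda>e. x e + s * - z e)"
        by (elim exE conjE)
      \<comment> \<open>\<open>x\<close> lies between the two boundary points, at parameter
        distances \<open>t\<close> and \<open>s\<close> along \<open>z\<close>; this fixes the
        weights \<open>s / (s + t)\<close> and \<open>t / (s + t)\<close>.\<close>
      have "s / (s + t) * (x e + t * z e) + (1 - s / (s + t)) * (x e + s * - z e) = x e" for e
      proof -
        have "l * (x e + t * z e) + (1 - l) * (x e + s * - z e) = x e + z e * (l * (s + t) - s)" for l
          by (simp add: algebra_simps)
        moreover have "s / (s + t) * (s + t) - s = 0" using t(1) s(1) by simp
        ultimately show ?thesis by (simp only: mult_zero_right add_0_right)
      qed
      then show ?thesis
        using pm_hull_mix[OF t(2) s(2), of "s / (s + t)"] t(1) s(1) by simp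
    next
      case False
      then have one: "card (E \<inter> cut inc {v}) = 1" if "v \<in> V" for v using that by blast
      then have "perfect_matching inc V E E" by (simp add: perfect_matching_def)
      moreover have "x e = 1" if e: "e \<in> E" for e
      proof -
        obtain u v where uv: "inc e = {u, v}" "u \<in> V" using graphD[OF gr e] .
        have "e \<in> E \<inter> cut inc {u}" using cut_single[OF gr e] uv e by simp
        then have "E \<inter> cut inc {u} = {e}" using one[OF uv(2)] by (metis card_1_singletonE singletonD)
        moreover have "sum x (E \<inter> cut inc {u}) = 1" using ed uv(2) by (simp add: edmonds_def)
        ultimately show ?thesis by simp
      qed
      ultimately show ?thesis
        unfolding pm_hull_def by (intro exI[of _ "return_pmf E"]) simp
    qed
  qed
qed

section \<open>Resolving the squares\<close>

lemma even_card_involution: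
  assumes "finite A" "\<And>a. a \<in> A \<Longrightarrow> f a \<in> A \<and> f (f a) = a \<and> f a \<noteq> a"
  shows "even (card A)"
  using assms
proof (induction "card A" arbitrary: A rule: less_induct)
  case less
  show ?case
  proof (cases "A = {}")
    case False
    then obtain a where a: "a \<in> A" by blast
    let ?B = "A - {a, f a}"
    have fa: "f a \<in> A" "f (f a) = a" "f a \<noteq> a" using less.prems(2)[OF a] by auto
    have card: "card A = card ?B + 2"
      using less.prems(1) a fa card_mono[of A "{a, f a}"] by (simp add: card_Diff_subset)
    have B: "f b \<in> ?B \<and> f (f b) = b \<and> f b \<noteq> b" if b: "b \<in> ?B" for b
    proof -
      have fb: "f b \<in> A" "f (f b) = b" "f b \<noteq> b" using less.prems(2)[of b] b by auto
      have "f b \<noteq> a" using fb(2) b by auto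
      moreover have "f b \<noteq> f a" using fb(2) fa(2) b by auto
      ultimately show ?thesis using fb by simp
    qed
    have "even (card ?B)"
      by (rule less.hyps) (use card less.prems(1) B in auto)
    then show ?thesis using card by simp
  qed simp
qed

text \<open>Elements whose image stays in \<open>A\<close> pair off, so only the split pairs matter.
  Applied to nodes and to darts, this turns the parity of a set into the parity of the number of
  edges that cross it.\<close>

lemma involution_parity:
  assumes "finite A" "\<And>a. a \<in> A \<Longrightarrow> f (f a) = a \<and> f a \<noteq> a"
  shows "even (card A) \<longleftrightarrow> even (card {a \<in> A. f a \<notin> A})"
proof -
  have "even (card {a \<in> A. f a \<in> A})"
    by (rule even_card_involution[where f = f]) (use assms in auto)
  moreover have "card A = card {a \<in> A. f a \<in> A} + card {a \<in> A. f a \<notin> A}"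
    using assms(1) by (subst card_Un_disjoint[symmetric]) (auto intro: arg_cong[where f = card])
  ultimately show ?thesis by simp
qed

section \<open>Graphs with squares and the choice of rails\<close>

definition uncut :: "nat set set \<Rightarrow> nat set \<Rightarrow> bool" where
  "uncut F U \<longleftrightarrow> (\<forall>e\<in>F. e \<subseteq> U \<or> e \<inter> U = {})"

lemma uncutD: "uncut F U \<Longrightarrow> {u, w} \<in> F \<Longrightarrow> u \<in> U \<longleftrightarrow> w \<in> U"
  by (fastforce simp: uncut_def)

text \<open>\<open>K\<close> is the set of corners. Squares are not listed: \<open>r\<close> and
  \<open>g\<close> are commuting involutions without fixed points, and
  \<open>r v \<noteq> g v\<close> rules out fixed points of their composition, so the orbits
  \<open>{v, r v, g v, r (g v)}\<close> have four elements. The assumptions are symmetric in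
  \<open>r\<close> and \<open>g\<close>, which allows the two to be exchanged square by
  square.\<close>

locale square_graph =
  fixes V :: "nat set" and W :: "nat set set" and K :: "nat set" and r g :: "nat \<Rightarrow> nat"
  assumes finite_V: "finite V" and K_subset: "K \<subseteq> V"
    and W_edge: "e \<in> W \<Longrightarrow> e \<subseteq> V \<and> card e = 2"
    and deg_corner: "v \<in> K \<Longrightarrow> card {w. {v, w} \<in> W} = 1"
    and deg_pass: "v \<in> V - K \<Longrightarrow> card {w. {v, w} \<in> W} = 2"
    and r_K: "v \<in> K \<Longrightarrow> r v \<in> K" and g_K: "v \<in> K \<Longrightarrow> g v \<in> K"
    and rr: "v \<in> K \<Longrightarrow> r (r v) = v" and gg: "v \<in> K \<Longrightarrow> g (g v) = v"
    and rg: "v \<in> K \<Longrightarrow> r (g v) = g (r v)"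
    and r_neq: "v \<in> K \<Longrightarrow> r v \<noteq> v" and g_neq: "v \<in> K \<Longrightarrow> g v \<noteq> v"
    and r_neq_g: "v \<in> K \<Longrightarrow> r v \<noteq> g v"
begin

lemma W_ends: "{u, w} \<in> W \<Longrightarrow> u \<in> V \<and> w \<in> V \<and> u \<noteq> w"
  using W_edge[of "{u, w}"] by (auto simp: card_insert_if split: if_splits)

lemma W_pair:
  assumes "e \<in> W"
  obtains u w where "e = {u, w}" "u \<noteq> w" "u \<in> V" "w \<in> V"
proof -
  obtain u w where "e = {u, w}" using W_edge[OF assms] by (auto simp: card_2_iff)
  then show thesis using that W_ends assms by blast
qed

lemma gr_neq: "v \<in> K \<Longrightarrow> g (r v) \<noteq> v"
  using r_neq_g gg r_K by metis

text \<open>Handshake lemma for the 1-edges inside \<open>S\<close>: none of them leaves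
  \<open>S\<close>, corners have degree 1 and all other vertices degree 2.\<close>

lemma uncut_even_corners:
  assumes S: "S \<subseteq> V" "uncut W S"
  shows "even (card (S \<inter> K))"
proof -
  let ?N = "\<lambda>u. {w. {u, w} \<in> W}"
  have finN: "finite (?N u)" for u
    by (rule finite_subset[OF _ finite_V]) (use W_ends in auto)
  have finS: "finite S" using S(1) finite_V finite_subset by blast
  have "even (card (Sigma S ?N))"
  proof (rule even_card_involution)
    show "finite (Sigma S ?N)" using finS finN by blast
    fix a assume a: "a \<in> Sigma S ?N"
    obtain u w where uw: "a = (u, w)" "u \<in> S" "{u, w} \<in> W" using a by auto
    have "w \<in> S" using uncutD[OF S(2) uw(3)] uw(2) by simp
    then show "prod.swap a \<in> Sigma S ?N \<and> prod.swap (prod.swap a) = a \<and> prod.swap a \<noteq> a"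
      using uw W_ends[OF uw(3)] by (auto simp: insert_commute)
  qed
  moreover have "card (Sigma S ?N) = (\<Sum>u\<in>S. card (?N u))" using finS finN by simp
  also have "\<dots> = (\<Sum>u\<in>S \<inter> K. card (?N u)) + (\<Sum>u\<in>S - K. card (?N u))"
    using finS by (subst sum.union_disjoint[symmetric]) (auto intro: sum.cong)
  also have "\<dots> = card (S \<inter> K) + 2 * card (S - K)"
    using deg_corner deg_pass S(1) by (auto simp: subset_iff)
  ultimately show ?thesis by simp
qed

text \<open>\<open>X\<close> collects the corners of the squares whose rails run along
  \<open>g\<close>. Then \<open>swap X r g\<close> is the mate along the rail, and
  \<open>swap X g r\<close> the mate along the rung.\<close>

definition swap :: "nat set \<Rightarrow> (nat \<Rightarrow> nat) \<Rightarrow> (nat \<Rightarrow> nat) \<Rightarrow> nat \<Rightarrow> nat" where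
  "swap X f h v = (if v \<in> X then h v else f v)"

definition mates_closed :: "nat set \<Rightarrow> bool" where
  "mates_closed X \<longleftrightarrow> X \<subseteq> K \<and> (\<forall>v\<in>X. r v \<in> X \<and> g v \<in> X)"

text \<open>Connectivity phrased by cuts instead of walks: a vertex set that no remaining edge
  crosses is trivial. Squares in \<open>Y\<close> are resolved and keep only their rails; squares
  outside \<open>Y\<close> keep all four edges.\<close>

definition resolved_connected :: "nat set \<Rightarrow> nat set \<Rightarrow> bool" where
  "resolved_connected X Y \<longleftrightarrow> (\<forall>U\<subseteq>V. uncut W U \<and> (\<forall>v\<in>Y. v \<in> U \<longleftrightarrow> swap X r g v \<in> U)
     \<and> (\<forall>v\<in>K - Y. (v \<in> U \<longleftrightarrow> r v \<in> U) \<and> (v \<in> U \<longleftrightarrow> g v \<in> U)) \<longrightarrow> U = {} \<or> U = V)"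

lemma resolved_connectedD:
  assumes "resolved_connected X Y" "U \<subseteq> V" "uncut W U" "\<And>v. v \<in> Y \<Longrightarrow> v \<in> U \<longleftrightarrow> swap X r g v \<in> U"
    "\<And>v. v \<in> K - Y \<Longrightarrow> (v \<in> U \<longleftrightarrow> r v \<in> U) \<and> (v \<in> U \<longleftrightarrow> g v \<in> U)"
  shows "U = {} \<or> U = V"
  using assms unfolding resolved_connected_def by blast

text \<open>The conditions are invariant under complement, so the separating set may be taken to
  contain a prescribed vertex. This lets two such sets be intersected at a common corner.\<close>

lemma not_resolved_connected:
  assumes "\<not> resolved_connected X Y" "Y \<subseteq> K" "a \<in> V"
  obtains U where "U \<subseteq> V" "uncut W U" "\<And>v. v \<in> Y \<Longrightarrow> v \<in> U \<longleftrightarrow> swap X r g v \<in> U"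
    "\<And>v. v \<in> K - Y \<Longrightarrow> (v \<in> U \<longleftrightarrow> r v \<in> U) \<and> (v \<in> U \<longleftrightarrow> g v \<in> U)" "U \<noteq> {}" "U \<noteq> V" "a \<in> U"
proof -
  obtain U where U: "U \<subseteq> V" "uncut W U" "\<forall>v\<in>Y. v \<in> U \<longleftrightarrow> swap X r g v \<in> U"
    "\<forall>v\<in>K - Y. (v \<in> U \<longleftrightarrow> r v \<in> U) \<and> (v \<in> U \<longleftrightarrow> g v \<in> U)" "U \<noteq> {}" "U \<noteq> V"
    using assms(1) unfolding resolved_connected_def by blast
  show thesis
  proof (cases "a \<in> U")
    case True
    then show thesis using U by (intro that[of U]) auto
  next
    case False
    have mem: "r v \<in> V" "g v \<in> V" "v \<in> V" if "v \<in> K" for v using that r_K g_K K_subset by auto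
    have swV: "swap X r g v \<in> V" "v \<in> V" if "v \<in> Y" for v
      using that mem assms(2) by (auto simp: swap_def)
    have "uncut W (V - U)"
      unfolding uncut_def
    proof
      fix e assume "e \<in> W"
      then obtain u w where "e = {u, w}" "u \<in> V" "w \<in> V" using W_pair by metis
      then show "e \<subseteq> V - U \<or> e \<inter> (V - U) = {}" using uncutD[OF U(2)] \<open>e \<in> W\<close> by auto
    qed
    moreover have "V - U \<noteq> {}" "V - U \<noteq> V" using U(1,5,6) by auto
    ultimately show thesis
      using False assms(3) swV mem U(3,4) by (intro that[of "V - U"]) auto
  qed
qed

text \<open>Kotzig's argument: were both ways of resolving a square to disconnect the graph, then the
  intersection of the two disconnecting sets would be an uncut set with an odd number of corners.\<close>
lemma resolve_all:
  assumes "resolved_connected X Y" "mates_closed X" "mates_closed Y" "X \<subseteq> Y"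
  shows "\<exists>X. mates_closed X \<and> resolved_connected X K"
  using assms
proof (induction "card (K - Y)" arbitrary: X Y rule: less_induct)
  case less
  note con = less.prems(1) and X = less.prems(2) and Y = less.prems(3) and XY = less.prems(4)
  show ?case
  proof (cases "Y = K")
    case True
    then show ?thesis using con X by blast
  next
    case False
    then obtain a where a: "a \<in> K" "a \<notin> Y" using Y by (auto simp: mates_closed_def)
    define Q where "Q = {a, r a, g a, r (g a)}"
    have Q: "mates_closed Q" "Q \<subseteq> K"
      using a r_K g_K rr gg rg by (auto simp: Q_def mates_closed_def)
    have out: "b \<notin> Y" if "b \<in> Q" for b
    proof
      assume b: "b \<in> Y"
      have "r b \<in> Y" "g b \<in> Y" "r (g b) \<in> Y" using b Y by (auto simp: mates_closed_def)
      then show False using that a rr gg rg g_K r_K unfolding Q_def by (metis b empty_iff insert_iff)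
    qed
    have YQ: "mates_closed (Y \<union> Q)" "mates_closed (X \<union> Q)"
      using Q Y X by (auto simp: mates_closed_def)
    have finK: "finite K" using K_subset finite_V finite_subset by blast
    have less': "card (K - (Y \<union> Q)) < card (K - Y)"
      using a finK by (intro psubset_card_mono) (auto simp: Q_def)
    have "resolved_connected X (Y \<union> Q) \<or> resolved_connected (X \<union> Q) (Y \<union> Q)"
    proof (rule ccontr)
      assume neg: "\<not> ?thesis"
      have aV: "a \<in> V" using a K_subset by blast
      have YQK: "Y \<union> Q \<subseteq> K" using YQ by (simp add: mates_closed_def)
      obtain U1 where U1: "U1 \<subseteq> V" "uncut W U1" "\<And>v. v \<in> Y \<union> Q \<Longrightarrow> v \<in> U1 \<longleftrightarrow> swap X r g v \<in> U1"
        "\<And>v. v \<in> K - (Y \<union> Q) \<Longrightarrow> (v \<in> U1 \<longleftrightarrow> r v \<in> U1) \<and> (v \<in> U1 \<longleftrightarrow> g v \<in> U1)"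
        "U1 \<noteq> {}" "U1 \<noteq> V" "a \<in> U1"
        using not_resolved_connected[OF _ YQK aV] neg by blast
      obtain U2 where U2: "U2 \<subseteq> V" "uncut W U2" "\<And>v. v \<in> Y \<union> Q \<Longrightarrow> v \<in> U2 \<longleftrightarrow> swap (X \<union> Q) r g v \<in> U2"
        "\<And>v. v \<in> K - (Y \<union> Q) \<Longrightarrow> (v \<in> U2 \<longleftrightarrow> r v \<in> U2) \<and> (v \<in> U2 \<longleftrightarrow> g v \<in> U2)"
        "U2 \<noteq> {}" "U2 \<noteq> V" "a \<in> U2"
        using not_resolved_connected[OF _ YQK aV] neg by blast
      have sw: "swap X r g v = r v" "swap (X \<union> Q) r g v = g v" if "v \<in> Q" for v
        using that out XY by (auto simp: swap_def)
      have sw': "swap (X \<union> Q) r g v = swap X r g v" if "v \<in> Y" for v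
        using that out by (auto simp: swap_def)
      have r1: "v \<in> U1 \<longleftrightarrow> r v \<in> U1" if "v \<in> Q" for v using U1(3)[of v] sw that by auto
      have g2: "v \<in> U2 \<longleftrightarrow> g v \<in> U2" if "v \<in> Q" for v using U2(3)[of v] sw that by auto
      have aQ: "a \<in> Q" "r a \<in> Q" "g a \<in> Q" by (auto simp: Q_def)
      \<comment> \<open>Otherwise \<open>U1\<close> contains all of \<open>Q\<close> and separates
        the graph even with this square intact, against \<open>con\<close>. So \<open>U1\<close>
        meets \<open>Q\<close> in \<open>a\<close> and \<open>r a\<close> only, and likewise
        \<open>U2\<close> meets it in \<open>a\<close> and \<open>g a\<close> only.\<close>
      have "g a \<notin> U1"
      proof
        assume ga: "g a \<in> U1"
        then have "Q \<subseteq> U1" using U1(7) r1 aQ by (auto simp: Q_def)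
        then have "v \<in> K - Y \<Longrightarrow> (v \<in> U1 \<longleftrightarrow> r v \<in> U1) \<and> (v \<in> U1 \<longleftrightarrow> g v \<in> U1)" for v
          using U1(4) Q(1) by (cases "v \<in> Q") (auto simp: mates_closed_def)
        then show False using resolved_connectedD[OF con U1(1,2)] U1(3,5,6) by auto
      qed
      have "r a \<notin> U2"
      proof
        assume ra: "r a \<in> U2"
        have "r (g a) \<in> U2" using ra g2[OF aQ(2)] rg a by simp
        then have "Q \<subseteq> U2" using ra U2(7) g2 aQ by (auto simp: Q_def)
        then have "v \<in> K - Y \<Longrightarrow> (v \<in> U2 \<longleftrightarrow> r v \<in> U2) \<and> (v \<in> U2 \<longleftrightarrow> g v \<in> U2)" for v
          using U2(4) Q(1) by (cases "v \<in> Q") (auto simp: mates_closed_def)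
        then show False using resolved_connectedD[OF con U2(1,2)] U2(3,5,6) sw' by auto
      qed
      define S where "S = U1 \<inter> U2"
      have S: "S \<subseteq> V" "uncut W S" using U1(1,2) U2(2) unfolding S_def uncut_def by blast+
      have "S \<inter> Q = {a}"
        using U1(7) U2(7) \<open>r a \<notin> U2\<close> \<open>g a \<notin> U1\<close> r1[OF aQ(3)] by (auto simp: S_def Q_def)
      then have "S \<inter> K = insert a (S \<inter> K - Q)" using a(1) by blast
      moreover have "a \<notin> S \<inter> K - Q" "finite (S \<inter> K - Q)" using aQ(1) finK by auto
      ultimately have "card (S \<inter> K) = card (S \<inter> K - Q) + 1" by (metis Suc_eq_plus1 card_insert_disjoint)
      \<comment> \<open>All other corners of \<open>S\<close> pair up: along the rail in resolved
        squares, along \<open>r\<close> in those still intact. With \<open>a\<close> as the only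
        corner in \<open>Q\<close>, the number of corners in \<open>S\<close> is odd.\<close>
      moreover have "even (card (S \<inter> K - Q))"
      proof (rule even_card_involution[where f = "swap X r g"])
        show "finite (S \<inter> K - Q)" using finK by blast
        fix v assume v: "v \<in> S \<inter> K - Q"
        have sQ: "swap X r g v \<in> K - Q" "swap X r g (swap X r g v) = v" "swap X r g v \<noteq> v"
          using v Q X r_K g_K rr gg r_neq g_neq by (auto simp: swap_def mates_closed_def)
        moreover have "swap X r g v \<in> S"
        proof (cases "v \<in> Y")
          case True
          then show ?thesis using v U1(3) U2(3) sw' by (auto simp: S_def)
        next
          case False
          then have "swap X r g v = r v" using XY by (auto simp: swap_def)
          then show ?thesis using v False U1(4) U2(4) by (auto simp: S_def)
        qed
        ultimately show "swap X r g v \<in> S \<inter> K - Q \<and> swap X r g (swap X r g v) = v \<and> swap X r g v \<noteq> v"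
          by blast
      qed
      ultimately show False using uncut_even_corners[OF S] by simp
    qed
    then show ?thesis
      using less.hyps[OF less' _ X YQ(1)] less.hyps[OF less' _ YQ(2) YQ(1)] XY by blast
  qed
qed

lemma swap_square_graph:
  assumes X: "mates_closed X"
  shows "square_graph V W K (swap X r g) (swap X g r)"
proof -
  have X': "r v \<in> X \<longleftrightarrow> v \<in> X" "g v \<in> X \<longleftrightarrow> v \<in> X" if "v \<in> K" for v
    using X that rr[OF that] gg[OF that] unfolding mates_closed_def by metis+
  show ?thesis
    by unfold_locales
      (use finite_V K_subset W_edge deg_corner deg_pass r_K g_K rr gg rg r_neq g_neq r_neq_g X' in
        \<open>auto simp: swap_def\<close>, metis r_neq_g)
qed

end

section \<open>The contracted cubic graph\<close>

text \<open>A rung is named by its vertex set, so \<open>v\<close> and \<open>g v\<close> give the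
  same node. \<open>Dart u w\<close> is the end at \<open>u\<close> of the 1-edge
  \<open>{u, w}\<close>, used when \<open>u\<close> is not a corner.\<close>

datatype gnode = Rung "nat set" | Dart nat nat
datatype gedge = Path "nat set" | Square "nat set" | Pass nat

text \<open>The last assumption says that no cut of the contracted graph consists of a single merged
  rail: \<open>v\<close> and \<open>g v\<close> are the corners of one square that lie in
  \<open>S\<close>, so a further crossing corner \<open>u\<close> belongs to another square.\<close>

locale bridgeless_square_graph = square_graph +
  assumes rung_not_W: "v \<in> K \<Longrightarrow> {v, g v} \<notin> W"
    and rail_not_W: "v \<in> K \<Longrightarrow> {v, r v} \<notin> W"
    and no_single_crossing: "\<lbrakk>S \<subseteq> V; uncut W S; \<And>u. u \<in> K \<Longrightarrow> u \<in> S \<longleftrightarrow> g u \<in> S; v \<in> K; v \<in> S; r v \<notin> S\<rbrakk>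
      \<Longrightarrow> \<exists>u\<in>K \<inter> S. r u \<notin> S \<and> u \<noteq> v \<and> u \<noteq> g v"
begin

definition partner :: "nat \<Rightarrow> nat" where
  "partner v = (THE w. {v, w} \<in> W)"

definition other :: "nat \<Rightarrow> nat \<Rightarrow> nat" where
  "other u w = (THE w'. {u, w'} \<in> W \<and> w' \<noteq> w)"

lemma partner: "v \<in> K \<Longrightarrow> {v, w} \<in> W \<longleftrightarrow> w = partner v"
proof -
  assume "v \<in> K"
  then obtain a where "{w. {v, w} \<in> W} = {a}" using deg_corner card_1_singletonE by metis
  then have "\<And>w. {v, w} \<in> W \<longleftrightarrow> w = a" by blast
  then show ?thesis unfolding partner_def by simp
qed

lemma corner_edge:
  assumes v: "v \<in> K" and f: "f \<in> W"
  shows "v \<in> f \<longleftrightarrow> f = {v, partner v}"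
proof
  assume "v \<in> f"
  obtain a b where ab: "f = {a, b}" using W_pair[OF f] .
  then obtain x where "f = {v, x}" using \<open>v \<in> f\<close> by (auto simp: insert_commute)
  then show "f = {v, partner v}" using partner[OF v, of x] f by simp
qed simp

lemma other:
  assumes u: "u \<in> V - K" and w: "{u, w} \<in> W"
  shows "{u, w'} \<in> W \<longleftrightarrow> w' = w \<or> w' = other u w" "other u w \<noteq> w"
proof -
  obtain a b where ab: "{w. {u, w} \<in> W} = {a, b}" "a \<noteq> b"
    using deg_pass[OF u] by (auto simp: card_2_iff)
  then have iff: "\<And>w'. {u, w'} \<in> W \<longleftrightarrow> w' = a \<or> w' = b" by blast
  have "other u w = (if w = a then b else a)"
    unfolding other_def iff using w iff ab(2) by (auto intro!: the_equality)
  then show "{u, w'} \<in> W \<longleftrightarrow> w' = w \<or> w' = other u w" "other u w \<noteq> w"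
    using w iff ab(2) by auto
qed

lemma other_other:
  assumes "u \<in> V - K" "{u, w} \<in> W"
  shows "{u, other u w} \<in> W" "other u (other u w) = w"
proof -
  show 1: "{u, other u w} \<in> W" using other(1)[OF assms] by simp
  have "{u, w} \<in> W \<longleftrightarrow> w = other u w \<or> w = other u (other u w)" by (rule other(1)[OF assms(1) 1])
  then show "other u (other u w) = w" using assms(2) other(2)[OF assms] by metis
qed

lemma pass_nbr:
  assumes "u \<in> V - K"
  obtains w where "{u, w} \<in> W"
proof -
  have "card {w. {u, w} \<in> W} \<noteq> 0" using deg_pass[OF assms] by simp
  then obtain w where "{u, w} \<in> W" by (metis (no_types, lifting) card.empty empty_Collect_eq)
  then show thesis by (rule that)
qed

definition square :: "nat \<Rightarrow> nat set" where
  "square v = {v, r v, g v, r (g v)}"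

lemma square_eq:
  assumes "v \<in> K" "w \<in> square v"
  shows "square w = square v"
  using assms r_K g_K rr gg rg by (auto simp: square_def)

lemma self_in_square: "v \<in> square v" by (simp add: square_def)

text \<open>The cubic graph obtained by contracting the rungs of every square and merging its two rails;
  a vertex outside the squares is replaced by an edge, so that a perfect matching
  uses either none or both of its 1-edges.\<close>

definition node :: "nat \<Rightarrow> nat \<Rightarrow> gnode" where
  "node v w = (if v \<in> K then Rung {v, g v} else Dart v w)"

fun ends :: "gedge \<Rightarrow> gnode set" where
  "ends (Path e) = {node u w |u w. e = {u, w}}"
| "ends (Square q) = {Rung {v, g v} |v. v \<in> q}"
| "ends (Pass u) = {Dart u w |w. {u, w} \<in> W}"

definition nodes :: "gnode set" where
  "nodes = {node u w |u w. {u, w} \<in> W}"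

definition edges :: "gedge set" where
  "edges = Path ` W \<union> Square ` square ` K \<union> Pass ` (V - K)"

text \<open>A rung node sees two paths and a square, 1/4 + 1/4 + 1/2 = 1. A dart sees only its path
  and the pass edge, which forces 3/4 for \<open>Pass\<close>.\<close>

fun weight :: "gedge \<Rightarrow> real" where
  "weight (Path e) = 1/4"
| "weight (Square q) = 1/2"
| "weight (Pass u) = 3/4"

lemma ends_Path: "ends (Path {u, w}) = {node u w, node w u}"
  by (auto simp: doubleton_eq_iff)

lemma ends_Square:
  assumes "v \<in> K"
  shows "ends (Square (square v)) = {Rung {v, g v}, Rung {r v, g (r v)}}"
  using assms gg rg r_K g_K rr by (auto simp: square_def insert_commute)

lemma ends_Pass:
  assumes "u \<in> V - K" "{u, w} \<in> W"
  shows "ends (Pass u) = {Dart u w, Dart u (other u w)}"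
  using other(1)[OF assms] by auto

declare ends.simps [simp del]

lemma finite_W: "finite W"
  by (rule finite_subset[of _ "Pow V"]) (use W_edge finite_V in auto)

lemma finite_K: "finite K"
  using K_subset finite_V finite_subset by blast

lemma finite_edges: "finite edges"
  using finite_W finite_K finite_V by (simp add: edges_def)

lemma node_Rung:
  assumes "v \<in> K"
  shows "node u w = Rung {v, g v} \<longleftrightarrow> u = v \<or> u = g v"
  using assms g_K gg by (auto simp: node_def doubleton_eq_iff)

lemma node_in_nodes: "{u, w} \<in> W \<Longrightarrow> node u w \<in> nodes"
  unfolding nodes_def by blast

lemma node_Rung_in_nodes:
  assumes "v \<in> K"
  shows "Rung {v, g v} \<in> nodes"
proof -
  have "{v, partner v} \<in> W" using partner[OF assms] by simp
  moreover have "Rung {v, g v} = node v (partner v)" using assms by (simp add: node_def)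
  ultimately show ?thesis unfolding nodes_def by blast
qed

lemma nodes_cases:
  assumes "x \<in> nodes"
  obtains v where "v \<in> K" "x = Rung {v, g v}" | u w where "u \<in> V - K" "{u, w} \<in> W" "x = Dart u w"
  using assms W_ends unfolding nodes_def node_def by (auto split: if_splits)

lemma finite_nodes: "finite nodes"
proof -
  have "nodes \<subseteq> (\<lambda>(u, w). node u w) ` (V \<times> V)" unfolding nodes_def using W_ends by auto
  then show ?thesis using finite_V finite_subset by blast
qed

text \<open>Contracting rungs creates no loop, because no 1-edge is parallel to a rung and a merged
  rail joins two distinct rungs.\<close>

lemma graph_ends: "graph ends nodes edges"
proof -
  have "ends e \<subseteq> nodes \<and> card (ends e) = 2" if e: "e \<in> edges" for e
  proof -
    consider (path) f where "f \<in> W" "e = Path f" | (square) v where "v \<in> K" "e = Square (square v)"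
      | (pass) u where "u \<in> V - K" "e = Pass u"
      using e by (auto simp: edges_def)
    then show ?thesis
    proof cases
      case path
      then obtain u w where uw: "f = {u, w}" "u \<noteq> w" using W_pair by metis
      have "node u w \<noteq> node w u"
        using uw path rung_not_W[of u] by (auto simp: node_def doubleton_eq_iff)
      moreover have "node u w \<in> nodes" "node w u \<in> nodes"
        using path(1) uw(1) node_in_nodes[of u w] node_in_nodes[of w u] by (simp_all add: insert_commute)
      ultimately show ?thesis using path uw ends_Path by simp
    next
      case square
      have "r v \<in> K" using square r_K by blast
      then have "Rung {v, g v} \<in> nodes" "Rung {r v, g (r v)} \<in> nodes"
        using square node_Rung_in_nodes by blast+
      moreover have "{v, g v} \<noteq> {r v, g (r v)}"
        using r_neq[OF square(1)] gr_neq[OF square(1)] by (auto simp: doubleton_eq_iff)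
      ultimately show ?thesis using square ends_Square by simp
    next
      case pass
      obtain w where w: "{u, w} \<in> W" using pass_nbr[OF pass(1)] .
      have "node u w \<in> nodes" "node u (other u w) \<in> nodes"
        using w other_other(1)[OF pass(1) w] unfolding nodes_def by blast+
      then show ?thesis
        using pass ends_Pass[OF pass(1) w] other(2)[OF pass(1) w] by (simp add: node_def)
    qed
  qed
  then show ?thesis using finite_nodes finite_edges by (simp add: graph_def)
qed

lemma star_Rung:
  assumes v: "v \<in> K"
  shows "edges \<inter> cut ends {Rung {v, g v}} = {Path {v, partner v}, Path {g v, partner (g v)}, Square (square v)}"
proof -
  have in_cut: "e \<in> cut ends {Rung {v, g v}} \<longleftrightarrow> Rung {v, g v} \<in> ends e" if "e \<in> edges" for e
    using cut_single[OF graph_ends that] .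
  have path: "Rung {v, g v} \<in> ends (Path f) \<longleftrightarrow> f = {v, partner v} \<or> f = {g v, partner (g v)}" if f: "f \<in> W" for f
  proof -
    obtain u w where uw: "f = {u, w}" using W_pair[OF f] by metis
    have "Rung {v, g v} \<in> ends (Path f) \<longleftrightarrow> v \<in> f \<or> g v \<in> f"
      using node_Rung[OF v, of u w] node_Rung[OF v, of w u] uw
      by (auto simp: ends_Path)
    also have "\<dots> \<longleftrightarrow> f = {v, partner v} \<or> f = {g v, partner (g v)}"
      using corner_edge[OF v f] corner_edge[OF g_K[OF v] f] by simp
    finally show ?thesis .
  qed
  have square: "Rung {v, g v} \<in> ends (Square (square u)) \<longleftrightarrow> square u = square v" if u: "u \<in> K" for u
  proof
    assume "Rung {v, g v} \<in> ends (Square (square u))"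
    then have "v \<in> square u" using ends_Square[OF u] rg[OF u] by (auto simp: square_def doubleton_eq_iff)
    then show "square u = square v" using square_eq[OF u] by simp
  next
    assume "square u = square v"
    then show "Rung {v, g v} \<in> ends (Square (square u))" using ends_Square[OF v] by simp
  qed
  have pass: "Rung {v, g v} \<notin> ends (Pass u)" for u by (simp add: ends.simps)
  have W: "{v, partner v} \<in> W" "{g v, partner (g v)} \<in> W" using partner v g_K by blast+
  show ?thesis
  proof (intro set_eqI iffI)
    fix e assume e: "e \<in> edges \<inter> cut ends {Rung {v, g v}}"
    then have "Rung {v, g v} \<in> ends e" using in_cut by blast
    then show "e \<in> {Path {v, partner v}, Path {g v, partner (g v)}, Square (square v)}"
      using e path square pass by (auto simp: edges_def)
  next
    fix e assume e: "e \<in> {Path {v, partner v}, Path {g v, partner (g v)}, Square (square v)}"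
    then have "e \<in> edges" "Rung {v, g v} \<in> ends e" using W v path square by (auto simp: edges_def)
    then show "e \<in> edges \<inter> cut ends {Rung {v, g v}}" using in_cut by blast
  qed
qed

lemma star_Dart:
  assumes u: "u \<in> V - K" and w: "{u, w} \<in> W"
  shows "edges \<inter> cut ends {Dart u w} = {Path {u, w}, Pass u}"
proof -
  have in_cut: "e \<in> cut ends {Dart u w} \<longleftrightarrow> Dart u w \<in> ends e" if "e \<in> edges" for e
    using cut_single[OF graph_ends that] .
  have path: "Dart u w \<in> ends (Path f) \<longleftrightarrow> f = {u, w}" if f: "f \<in> W" for f
  proof -
    obtain a b where ab: "f = {a, b}" using W_pair[OF f] by metis
    then show ?thesis using u by (auto simp: ends_Path node_def doubleton_eq_iff)
  qed
  have square: "Dart u w \<notin> ends (Square q)" for q by (simp add: ends.simps)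
  have pass: "Dart u w \<in> ends (Pass u') \<longleftrightarrow> u' = u" for u' using w by (auto simp: ends.simps)
  show ?thesis
  proof (intro set_eqI iffI)
    fix e assume e: "e \<in> edges \<inter> cut ends {Dart u w}"
    then have "Dart u w \<in> ends e" using in_cut by blast
    then show "e \<in> {Path {u, w}, Pass u}"
      using e path square pass by (auto simp: edges_def)
  next
    fix e assume e: "e \<in> {Path {u, w}, Pass u}"
    then have "e \<in> edges" "Dart u w \<in> ends e" using u w path pass by (auto simp: edges_def)
    then show "e \<in> edges \<inter> cut ends {Dart u w}" using in_cut by blast
  qed
qed

text \<open>A common path would be a 1-edge parallel to the rung. Distinctness is needed for the
  weights at a rung node to add up to 1.\<close>

lemma Path_neq:
  assumes "v \<in> K"
  shows "{v, partner v} \<noteq> {g v, partner (g v)}"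
proof
  assume "{v, partner v} = {g v, partner (g v)}"
  then have "partner v = g v" using g_neq[OF assms] by (auto simp: doubleton_eq_iff)
  then show False using rung_not_W[OF assms] partner[OF assms] by simp
qed

section \<open>Odd cut inequalities for the weights\<close>

lemma weight_cut:
  fixes S
  defines "w \<equiv> card {f \<in> W. Path f \<in> cut ends S}"
    and "s \<equiv> card {q \<in> square ` K. Square q \<in> cut ends S}"
    and "m \<equiv> card {u \<in> V - K. Pass u \<in> cut ends S}"
  shows "sum weight (edges \<inter> cut ends S) = real w / 4 + real s / 2 + 3 * real m / 4"
proof -
  let ?A = "{f \<in> W. Path f \<in> cut ends S}" and ?B = "{q \<in> square ` K. Square q \<in> cut ends S}"
    and ?C = "{u \<in> V - K. Pass u \<in> cut ends S}"
  have eq: "edges \<inter> cut ends S = Path ` ?A \<union> (Square ` ?B \<union> Pass ` ?C)" by (auto simp: edges_def)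
  have "finite ?A" "finite ?B" "finite ?C" using finite_W finite_K finite_V by auto
  then have "sum weight (edges \<inter> cut ends S) = sum weight (Path ` ?A) + (sum weight (Square ` ?B) + sum weight (Pass ` ?C))"
    unfolding eq by (subst sum.union_disjoint; auto)+
  moreover have "sum weight (Path ` ?A) = real w / 4" by (simp add: sum.reindex inj_on_def w_def)
  moreover have "sum weight (Square ` ?B) = real s / 2" by (simp add: sum.reindex inj_on_def s_def)
  moreover have "sum weight (Pass ` ?C) = 3 * real m / 4" by (simp add: sum.reindex inj_on_def m_def)
  ultimately show ?thesis by simp
qed

text \<open>The \<open>Square\<close> and \<open>Pass\<close> edges form a perfect matching of the
  contracted graph. Up to pairs inside \<open>S\<close>, every node of \<open>S\<close> therefore
  accounts for one such edge in the cut.\<close>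

lemma parity_nodes:
  assumes S: "S \<subseteq> nodes"
  shows "even (card S) \<longleftrightarrow> even (card {q \<in> square ` K. Square q \<in> cut ends S} + card {u \<in> V - K. Pass u \<in> cut ends S})"
proof -
  \<comment> \<open>\<open>\<eta> x\<close> is the \<open>Square\<close> or \<open>Pass\<close> edge
    at the node \<open>x\<close>, and \<open>\<mu> x\<close> is its other end.\<close>
  define \<mu> where "\<mu> x = (case x of Rung R \<Rightarrow> Rung (r ` R) | Dart u w \<Rightarrow> Dart u (other u w))" for x
  define \<eta> where "\<eta> x = (case x of Rung R \<Rightarrow> Square (R \<union> r ` R) | Dart u w \<Rightarrow> Pass u)" for x
  have \<mu>: "\<mu> (\<mu> x) = x \<and> \<mu> x \<noteq> x \<and> \<eta> x \<in> edges \<and> ends (\<eta> x) = {x, \<mu> x}" if x: "x \<in> nodes" for x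
    using x
  proof (cases rule: nodes_cases)
    case (1 v)
    have "r ` {v, g v} = {r v, g (r v)}" using rg[OF 1(1)] by simp
    moreover have "r ` {r v, g (r v)} = {v, g v}"
      using rg[OF 1(1)] rr[OF 1(1)] rr[OF g_K[OF 1(1)]] by simp
    moreover have "{v, g v} \<noteq> {r v, g (r v)}"
      using r_neq[OF 1(1)] gr_neq[OF 1(1)] by (auto simp: doubleton_eq_iff)
    moreover have "{v, g v} \<union> r ` {v, g v} = square v" by (auto simp: square_def)
    ultimately show ?thesis using 1 ends_Square[OF 1(1)] by (simp add: \<mu>_def \<eta>_def edges_def)
  next
    case (2 u w)
    then show ?thesis using other_other[OF 2(1,2)] other(2)[OF 2(1,2)] ends_Pass[OF 2(1,2)]
      by (auto simp: \<mu>_def \<eta>_def edges_def)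
  qed
  let ?N = "{x \<in> S. \<mu> x \<notin> S}"
  have finS: "finite S" using S finite_nodes finite_subset by blast
  have "even (card S) \<longleftrightarrow> even (card ?N)"
    by (rule involution_parity[OF finS]) (use S \<mu> in blast)
  moreover have "card ?N = card (\<eta> ` ?N)"
  proof (rule card_image[symmetric], rule inj_onI)
    fix x y assume "x \<in> ?N" "y \<in> ?N" "\<eta> x = \<eta> y"
    then show "x = y" using \<mu>[of x] \<mu>[of y] S by (auto simp: doubleton_eq_iff)
  qed
  moreover have "\<eta> ` ?N = Square ` {q \<in> square ` K. Square q \<in> cut ends S} \<union> Pass ` {u \<in> V - K. Pass u \<in> cut ends S}"
    (is "_ = ?R")
  proof
    show "\<eta> ` ?N \<subseteq> ?R"
    proof
      fix e assume "e \<in> \<eta> ` ?N"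
      then obtain x where x: "x \<in> S" "\<mu> x \<notin> S" "e = \<eta> x" by blast
      then have "e \<in> edges" "e \<in> cut ends S" using \<mu>[of x] S by (auto simp: cut_def)
      moreover have "\<forall>f. e \<noteq> Path f" by (auto simp: x(3) \<eta>_def split: gnode.splits)
      ultimately show "e \<in> ?R" by (auto simp: edges_def)
    qed
    show "?R \<subseteq> \<eta> ` ?N"
    proof
      fix e assume e: "e \<in> ?R"
      have "\<exists>x\<in>nodes. e = \<eta> x"
        using e
      proof
        assume "e \<in> Square ` {q \<in> square ` K. Square q \<in> cut ends S}"
        then obtain v where v: "v \<in> K" "e = Square (square v)" by blast
        have "{v, g v} \<union> r ` {v, g v} = square v" by (auto simp: square_def)
        then show ?thesis using v node_Rung_in_nodes[OF v(1)] by (intro bexI[of _ "Rung {v, g v}"]) (simp_all add: \<eta>_def)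
      next
        assume "e \<in> Pass ` {u \<in> V - K. Pass u \<in> cut ends S}"
        then obtain u where u: "u \<in> V - K" "e = Pass u" by blast
        obtain w where w: "{u, w} \<in> W" using pass_nbr[OF u(1)] .
        then have "node u w \<in> nodes" unfolding nodes_def by blast
        then show ?thesis using u by (intro bexI[of _ "node u w"]) (auto simp: \<eta>_def node_def)
      qed
      then obtain x where x: "x \<in> nodes" "e = \<eta> x" by blast
      have "e \<in> cut ends S" using e by auto
      then have cross: "(x \<in> S) \<noteq> (\<mu> x \<in> S)" using \<mu>[OF x(1)] x(2) by (auto simp: cut_def)
      have \<eta>\<mu>: "\<eta> (\<mu> x) = e"
        using x \<mu>[OF x(1)] by (cases rule: nodes_cases[OF x(1)])
          (auto simp: \<eta>_def \<mu>_def image_image)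
      show "e \<in> \<eta> ` ?N"
      proof (cases "x \<in> S")
        case True
        then show ?thesis using cross x(2) by blast
      next
        case False
        then have "\<mu> x \<in> ?N" using cross \<mu>[OF x(1)] by simp
        then show ?thesis using \<eta>\<mu> by (intro image_eqI[of _ _ "\<mu> x"]) simp_all
      qed
    qed
  qed
  moreover have "card ?R = card {q \<in> square ` K. Square q \<in> cut ends S} + card {u \<in> V - K. Pass u \<in> cut ends S}"
    using finite_K finite_V by (subst card_Un_disjoint) (auto simp: card_image inj_on_def)
  ultimately show ?thesis by simp
qed

text \<open>Both sides have the parity of the set \<open>A\<close> of darts whose node lies in
  \<open>S\<close>. Reversing a dart leaves \<open>A\<close> exactly at the paths of the cut. The
  second involution, \<open>\<nu>\<close>, turns to the other dart at the same rung, hence at the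
  same node, or at the same vertex outside \<open>K\<close>, where it leaves \<open>A\<close>
  exactly at the \<open>Pass\<close> edges of the cut.\<close>

lemma parity_darts:
  "even (card {f \<in> W. Path f \<in> cut ends S}) \<longleftrightarrow> even (card {u \<in> V - K. Pass u \<in> cut ends S})"
proof -
  define A where "A = {(u, w). {u, w} \<in> W \<and> node u w \<in> S}"
  define \<nu> where "\<nu> = (\<lambda>(u, w). if u \<in> K then (g u, partner (g u)) else (u, other u w))"
  have "A \<subseteq> V \<times> V" using W_ends by (auto simp: A_def)
  then have finA: "finite A" using finite_V finite_subset by blast
  have "even (card A) \<longleftrightarrow> even (card {a \<in> A. prod.swap a \<notin> A})"
    by (rule involution_parity[OF finA]) (use W_ends in \<open>auto simp: A_def\<close>)
  moreover have "card {a \<in> A. prod.swap a \<notin> A} = card ((\<lambda>(u, w). {u, w}) ` {a \<in> A. prod.swap a \<notin> A})"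
    by (rule card_image[symmetric]) (auto simp: inj_on_def doubleton_eq_iff)
  moreover have "(\<lambda>(u, w). {u, w}) ` {a \<in> A. prod.swap a \<notin> A} = {f \<in> W. Path f \<in> cut ends S}"
  proof (intro set_eqI iffI)
    fix f assume "f \<in> (\<lambda>(u, w). {u, w}) ` {a \<in> A. prod.swap a \<notin> A}"
    then obtain u w where uw: "f = {u, w}" "{u, w} \<in> W" "node u w \<in> S" "\<not> ({w, u} \<in> W \<and> node w u \<in> S)"
      by (auto simp: A_def)
    then have "node w u \<notin> S" by (auto simp: insert_commute)
    then show "f \<in> {f \<in> W. Path f \<in> cut ends S}" using uw ends_Path by (auto simp: cut_def)
  next
    fix f assume f: "f \<in> {f \<in> W. Path f \<in> cut ends S}"
    then obtain u w where uw: "f = {u, w}" using W_pair by blast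
    have "(node u w \<in> S) \<noteq> (node w u \<in> S)" using f uw ends_Path by (auto simp: cut_def)
    then have "(u, w) \<in> {a \<in> A. prod.swap a \<notin> A} \<or> (w, u) \<in> {a \<in> A. prod.swap a \<notin> A}"
      using f uw by (auto simp: A_def insert_commute)
    then show "f \<in> (\<lambda>(u, w). {u, w}) ` {a \<in> A. prod.swap a \<notin> A}"
      using uw by (force simp: insert_commute)
  qed
  moreover have "even (card A) \<longleftrightarrow> even (card {a \<in> A. \<nu> a \<notin> A})"
  proof (rule involution_parity[OF finA])
    fix a assume "a \<in> A"
    then obtain u w where uw: "a = (u, w)" "{u, w} \<in> W" "node u w \<in> S" by (auto simp: A_def)
    show "\<nu> (\<nu> a) = a \<and> \<nu> a \<noteq> a"
    proof (cases "u \<in> K")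
      case True
      then show ?thesis using uw g_K gg g_neq partner[OF True] by (simp add: \<nu>_def)
    next
      case False
      then have "u \<in> V - K" using W_ends[OF uw(2)] by blast
      then show ?thesis using other_other[OF _ uw(2)] other(2)[OF _ uw(2)] False uw by (auto simp: \<nu>_def)
    qed
  qed
  moreover have "card {a \<in> A. \<nu> a \<notin> A} = card (fst ` {a \<in> A. \<nu> a \<notin> A})"
  proof (rule card_image[symmetric], rule inj_onI)
    fix a b assume ab: "a \<in> {a \<in> A. \<nu> a \<notin> A}" "b \<in> {a \<in> A. \<nu> a \<notin> A}" "fst a = fst b"
    obtain u w w' where uw: "a = (u, w)" "b = (u, w')" using ab(3) by (metis prod.collapse)
    have W2: "{u, w} \<in> W" "{u, w'} \<in> W" using ab uw by (auto simp: A_def)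
    show "a = b"
    proof (cases "u \<in> K")
      case True
      then show ?thesis using partner[OF True] W2 uw by simp
    next
      case False
      then have u: "u \<in> V - K" using W_ends[OF W2(1)] by blast
      have "\<nu> a \<noteq> b" using ab by auto
      then have "w' \<noteq> other u w" using uw False by (simp add: \<nu>_def)
      then show ?thesis using other(1)[OF u W2(1), of w'] W2(2) uw by simp
    qed
  qed
  moreover have "fst ` {a \<in> A. \<nu> a \<notin> A} = {u \<in> V - K. Pass u \<in> cut ends S}"
  proof (intro set_eqI iffI)
    fix u assume "u \<in> fst ` {a \<in> A. \<nu> a \<notin> A}"
    then obtain a where a: "a \<in> A" "\<nu> a \<notin> A" "u = fst a" by blast
    define w where "w = snd a"
    have "a = (u, w)" using a(3) by (simp add: w_def)
    then have w: "{u, w} \<in> W" "node u w \<in> S" "\<nu> (u, w) \<notin> A" using a(1,2) by (auto simp: A_def)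
    have "u \<notin> K"
    proof
      assume u: "u \<in> K"
      then have "node (g u) (partner (g u)) = node u w"
        using g_K gg by (auto simp: node_def insert_commute)
      moreover have "{g u, partner (g u)} \<in> W" using partner[OF g_K[OF u]] by simp
      ultimately show False using w u by (simp add: \<nu>_def A_def)
    qed
    then have u: "u \<in> V - K" using W_ends[OF w(1)] by blast
    have "node u (other u w) \<notin> S" using w u other_other[OF u w(1)] by (auto simp: \<nu>_def A_def)
    then show "u \<in> {u \<in> V - K. Pass u \<in> cut ends S}"
      using u w ends_Pass[OF u w(1)] by (auto simp: cut_def node_def)
  next
    fix u assume u: "u \<in> {u \<in> V - K. Pass u \<in> cut ends S}"
    then have uK: "u \<in> V - K" by blast
    obtain w where "{u, w} \<in> W" using pass_nbr[OF uK] .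
    then obtain w where w: "{u, w} \<in> W" "Dart u w \<in> S"
      using u ends_Pass[OF uK] other_other[OF uK] by (auto simp: cut_def)
    then have "Dart u (other u w) \<notin> S" using u ends_Pass[OF uK w(1)] by (auto simp: cut_def)
    then have "(u, w) \<in> {a \<in> A. \<nu> a \<notin> A}" using w uK by (auto simp: A_def \<nu>_def node_def)
    then show "u \<in> fst ` {a \<in> A. \<nu> a \<notin> A}" by force
  qed
  ultimately show ?thesis by simp
qed

text \<open>With \<open>a\<close> paths, \<open>b\<close> squares and \<open>c\<close> passes in the
  cut, four times its weight is \<open>a + 2 * b + 3 * c\<close>. For \<open>b + c\<close> odd and
  \<open>a\<close>, \<open>c\<close> of equal parity this is below 4 only if \<open>a = 0\<close>,
  \<open>b = 1\<close>, \<open>c = 0\<close>, the single merged rail that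
  \<open>no_single_crossing\<close> excludes.\<close>

lemma edmonds_weight: "edmonds ends nodes edges weight"
  unfolding edmonds_def
proof (intro conjI ballI allI impI)
  show "graph ends nodes edges" by (rule graph_ends)
  show "0 \<le> weight e" for e by (cases e) auto
  show "sum weight (edges \<inter> cut ends {x}) = 1" if "x \<in> nodes" for x
    using that
  proof (cases rule: nodes_cases)
    case (1 v)
    then show ?thesis using star_Rung[OF 1(1)] Path_neq[OF 1(1)] by simp
  next
    case (2 u w)
    then show ?thesis using star_Dart[OF 2(1,2)] by simp
  qed
  fix S assume S: "S \<subseteq> nodes" "odd (card S)"
  let ?A = "{f \<in> W. Path f \<in> cut ends S}" and ?B = "{q \<in> square ` K. Square q \<in> cut ends S}"
    and ?C = "{u \<in> V - K. Pass u \<in> cut ends S}"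
  have fin: "finite ?A" "finite ?B" "finite ?C" using finite_W finite_K finite_V by auto
  have parity: "odd (card ?B + card ?C)" "even (card ?A) \<longleftrightarrow> even (card ?C)"
    using parity_nodes[OF S(1)] S(2) parity_darts by auto
  have "\<not> (card ?A = 0 \<and> card ?B = 1 \<and> card ?C = 0)"
  proof
    assume c: "card ?A = 0 \<and> card ?B = 1 \<and> card ?C = 0"
    then have A0: "?A = {}" and C0: "?C = {}" using fin by auto
    \<comment> \<open>The pullback of \<open>S\<close> to the original vertices. No
      \<open>Pass\<close> edge is cut, so both darts at a vertex outside \<open>K\<close> lie on the
      same side and the choice of \<open>w\<close> is immaterial.\<close>
    define U where "U = {v \<in> V. \<exists>w. {v, w} \<in> W \<and> node v w \<in> S}"
    have U: "u \<in> U \<longleftrightarrow> node u w \<in> S" if w: "{u, w} \<in> W" for u w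
    proof (cases "u \<in> K")
      case True
      then show ?thesis using w W_ends[OF w] by (auto simp: U_def node_def)
    next
      case False
      then have u: "u \<in> V - K" using W_ends[OF w] by blast
      then have "Dart u w \<in> S \<longleftrightarrow> Dart u (other u w) \<in> S"
        using C0 ends_Pass[OF u w] by (auto simp: cut_def)
      then show ?thesis using u w other(1)[OF u w] by (auto simp: U_def node_def)
    qed
    have UV: "U \<subseteq> V" by (auto simp: U_def)
    have clW: "uncut W U"
      unfolding uncut_def
    proof
      fix f assume f: "f \<in> W"
      then obtain u w where uw: "f = {u, w}" using W_pair by blast
      have "node u w \<in> S \<longleftrightarrow> node w u \<in> S" using A0 f uw ends_Path by (auto simp: cut_def)
      then show "f \<subseteq> U \<or> f \<inter> U = {}" using U[of u w] U[of w u] f uw by (auto simp: insert_commute)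
    qed
    have UK: "v \<in> U \<longleftrightarrow> Rung {v, g v} \<in> S" if v: "v \<in> K" for v
      using U[of v "partner v"] partner[OF v] v by (simp add: node_def)
    have clg: "v \<in> U \<longleftrightarrow> g v \<in> U" if v: "v \<in> K" for v
      using UK[OF v] UK[OF g_K[OF v]] gg[OF v] by (simp add: insert_commute)
    have cutB: "square v \<in> ?B" if v: "v \<in> K" "v \<in> U" "r v \<notin> U" for v
      using v UK[OF v(1)] UK[OF r_K[OF v(1)]] ends_Square[OF v(1)] by (auto simp: cut_def)
    obtain q where q: "?B = {q}" using c by (metis card_1_singletonE)
    have "q \<in> ?B" unfolding q by simp
    then obtain v0 where v0: "v0 \<in> K" "Square (square v0) \<in> cut ends S" by auto
    have "(v0 \<in> U) \<noteq> (r v0 \<in> U)"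
      using v0 UK[OF v0(1)] UK[OF r_K[OF v0(1)]] ends_Square[OF v0(1)] by (auto simp: cut_def)
    then obtain v where v: "v \<in> K" "v \<in> U" "r v \<notin> U"
      using v0(1) r_K rr by metis
    obtain v' where v': "v' \<in> K" "v' \<in> U" "r v' \<notin> U" "v' \<noteq> v" "v' \<noteq> g v"
      using no_single_crossing[OF UV clW _ v] clg by auto
    have "square v' = square v" using cutB[OF v] cutB[OF v'(1-3)] q by simp
    then have "v' \<in> square v" using self_in_square by metis
    moreover have "r (g v) \<notin> U" using clg[OF r_K[OF v(1)]] rg[OF v(1)] v(3) by simp
    ultimately show False using v' v by (auto simp: square_def)
  qed
  moreover have "4 \<le> a + 2 * b + 3 * c"
    if "\<not> (a = 0 \<and> b = 1 \<and> c = 0)" "odd (b + c)" "even a \<longleftrightarrow> even c" for a b c :: nat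
    using that by presburger
  ultimately have "4 \<le> card ?A + 2 * card ?B + 3 * card ?C" using parity by blast
  then have "4 \<le> real (card ?A + 2 * card ?B + 3 * card ?C)" by linarith
  then show "1 \<le> sum weight (edges \<inter> cut ends S)" unfolding weight_cut by simp
qed

end

section \<open>From matchings to tours\<close>

lemma TSP_KnI:
  assumes I: "finite I" and c: "\<And>i. i \<in> I \<Longrightarrow> 0 \<le> c i" "sum c I = 1"
    and t: "\<And>i. i \<in> I \<Longrightarrow> is_tour n (t i)" and y: "\<And>e. y e = (\<Sum>i\<in>I. c i * real (t i e))"
  shows "y \<in> TSP_Kn n"
proof -
  obtain h where h: "bij_betw h {0..<card I} I" using ex_bij_betw_nat_finite[OF I] by blast
  then have h': "bij_betw h {..<card I} I" by (simp add: atLeast0LessThan)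
  have "(\<Sum>i<card I. c (h i)) = 1" using sum.reindex_bij_betw[OF h', of c] c(2) by simp
  moreover have "y e = (\<Sum>i<card I. c (h i) * real (t (h i) e))" for e
    using sum.reindex_bij_betw[OF h', of "\<lambda>i. c i * real (t i e)"] y by simp
  moreover have "h i \<in> I" if "i < card I" for i using bij_betwE[OF h'] that by simp
  ultimately show ?thesis
    unfolding TSP_Kn_def using c(1) t
    by (intro CollectI exI[of _ "card I"] exI[of _ "\<lambda>i. c (h i)"] exI[of _ "\<lambda>i. t (h i)"]) auto
qed

context bridgeless_square_graph
begin

lemma matching_corner:
  assumes M: "perfect_matching ends nodes edges M" and v: "v \<in> K"
  shows "Square (square v) \<in> M \<Longrightarrow> Path {v, partner v} \<notin> M"
    and "Square (square v) \<notin> M \<Longrightarrow> Path {v, partner v} \<in> M \<longleftrightarrow> Path {g v, partner (g v)} \<notin> M"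
proof -
  have "M \<inter> cut ends {Rung {v, g v}} = M \<inter> (edges \<inter> cut ends {Rung {v, g v}})"
    using M by (auto simp: perfect_matching_def)
  then have "card (M \<inter> {Path {v, partner v}, Path {g v, partner (g v)}, Square (square v)}) = 1"
    using M node_Rung_in_nodes[OF v] unfolding star_Rung[OF v] perfect_matching_def by metis
  then obtain e where e: "M \<inter> {Path {v, partner v}, Path {g v, partner (g v)}, Square (square v)} = {e}"
    by (rule card_1_singletonE)
  have mem: "f \<in> M \<and> f \<in> {Path {v, partner v}, Path {g v, partner (g v)}, Square (square v)} \<longleftrightarrow> f = e" for f
    using e unfolding set_eq_iff by simp
  show "Square (square v) \<in> M \<Longrightarrow> Path {v, partner v} \<notin> M"
    using mem[of "Square (square v)"] mem[of "Path {v, partner v}"] by auto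
  show "Square (square v) \<notin> M \<Longrightarrow> Path {v, partner v} \<in> M \<longleftrightarrow> Path {g v, partner (g v)} \<notin> M"
    using mem[of "Path {v, partner v}"] mem[of "Path {g v, partner (g v)}"] mem[of e] Path_neq[OF v] by auto
qed

lemma matching_pass:
  assumes M: "perfect_matching ends nodes edges M" and u: "u \<in> V - K" and w: "{u, w} \<in> W"
  shows "Path {u, w} \<in> M \<longleftrightarrow> Pass u \<notin> M"
proof -
  have "M \<inter> cut ends {Dart u w} = M \<inter> (edges \<inter> cut ends {Dart u w})"
    using M by (auto simp: perfect_matching_def)
  moreover have "Dart u w \<in> nodes" using node_in_nodes[OF w] u by (simp add: node_def)
  ultimately have "card (M \<inter> {Path {u, w}, Pass u}) = 1"
    using M unfolding star_Dart[OF u w] perfect_matching_def by metis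
  then obtain e where e: "M \<inter> {Path {u, w}, Pass u} = {e}"
    by (rule card_1_singletonE)
  then have mem: "f \<in> M \<and> f \<in> {Path {u, w}, Pass u} \<longleftrightarrow> f = e" for f
    unfolding set_eq_iff by simp
  show ?thesis using mem[of "Path {u, w}"] mem[of "Pass u"] mem[of e] by auto
qed

section \<open>Multiplicities of the tours\<close>

text \<open>\<open>selected True\<close> marks the corners on the rail through the least vertex of
  the square, \<open>selected False\<close> those on the other rail; the minimum is only a canonical
  way to tell the rails apart. One bit serves all squares at once, since averaging needs only the
  mean multiplicity of each edge.\<close>

definition selected :: "bool \<Rightarrow> nat \<Rightarrow> bool" where
  "selected s v \<longleftrightarrow> (v = Min (square v) \<or> r v = Min (square v)) = s"

lemma selected:
  assumes "v \<in> K"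
  shows "selected s (r v) \<longleftrightarrow> selected s v" "selected s (g v) \<longleftrightarrow> \<not> selected s v"
proof -
  have sq: "square (r v) = square v" "square (g v) = square v"
    by (rule square_eq[OF assms]; simp add: square_def)+
  show "selected s (r v) \<longleftrightarrow> selected s v" unfolding selected_def sq rr[OF assms] by blast
  have "Min (square v) \<in> square v" by (rule Min_in) (auto simp: square_def)
  then have "Min (square v) = v \<or> Min (square v) = r v \<or> Min (square v) = g v \<or> Min (square v) = r (g v)"
    unfolding square_def by simp
  moreover have "v \<noteq> r v" "v \<noteq> g v" "r v \<noteq> g v" "v \<noteq> r (g v)" "r v \<noteq> r (g v)" "g v \<noteq> r (g v)"
    using r_neq[OF assms] g_neq[OF assms] r_neq_g[OF assms] gr_neq[OF assms] rg[OF assms]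
      r_neq[OF g_K[OF assms]] g_neq[OF r_K[OF assms]] by auto
  ultimately have "(g v = Min (square v) \<or> r (g v) = Min (square v)) \<longleftrightarrow> \<not> (v = Min (square v) \<or> r v = Min (square v))"
    by (elim disjE) simp_all
  then show "selected s (g v) \<longleftrightarrow> \<not> selected s v" unfolding selected_def sq by blast
qed

definition path_mult :: "gedge set \<Rightarrow> nat set \<Rightarrow> nat" where
  "path_mult M e = (if Path e \<in> M then 2 else 1)"

text \<open>In a square whose merged rail is not matched, each rung has exactly one end off the
  selected rail, so its sum has one nonzero term. That end has lost its rail, and the rung balances
  the degree by copying the multiplicity of the 1-edge there.\<close>

definition mult :: "gedge set \<Rightarrow> bool \<Rightarrow> nat set \<Rightarrow> nat" where
  "mult M s e =
    (if e \<in> W then path_mult M e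
     else if \<exists>v\<in>K. e = {v, r v} then (if \<exists>v\<in>e. Square (square v) \<in> M \<or> selected s v then 1 else 0)
     else if \<exists>v\<in>K. e = {v, g v} then
       (\<Sum>v\<in>e. if Square (square v) \<in> M \<or> selected s v then 0 else path_mult M {v, partner v})
     else 0)"

lemma mult_rail:
  assumes "v \<in> K"
  shows "mult M s {v, r v} = (if Square (square v) \<in> M \<or> selected s v then 1 else 0)"
proof -
  have "square (r v) = square v" by (rule square_eq[OF assms]) (simp add: square_def)
  then show ?thesis using assms rail_not_W[OF assms] selected(1)[OF assms] by (auto simp: mult_def)
qed

lemma rung_not_rail:
  assumes "v \<in> K" "w \<in> K"
  shows "{v, g v} \<noteq> {w, r w}"
  using r_neq_g[OF assms(2)] gr_neq[OF assms(2)] by (auto simp: doubleton_eq_iff)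

lemma mult_rung:
  assumes v: "v \<in> K"
  shows "mult M s {v, g v} = (if Square (square v) \<in> M then 0
    else if selected s v then path_mult M {g v, partner (g v)} else path_mult M {v, partner v})"
proof -
  have "square (g v) = square v" by (rule square_eq[OF v]) (simp add: square_def)
  moreover have "\<not> (\<exists>w\<in>K. {v, g v} = {w, r w})" using rung_not_rail v by blast
  moreover have "\<exists>w\<in>K. {v, g v} = {w, g w}" using v by blast
  ultimately show ?thesis
    using rung_not_W[OF v] selected(2)[OF v] g_neq[OF v] by (simp add: mult_def eq_commute[of v])
qed

lemma mult_path: "e \<in> W \<Longrightarrow> mult M s e = path_mult M e"
  by (simp add: mult_def)

lemma mult_outside:
  assumes "mult M s e \<noteq> 0"
  shows "e \<in> W \<or> (\<exists>v\<in>K. e = {v, r v}) \<or> (\<exists>v\<in>K. e = {v, g v})"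
  using assms by (auto simp: mult_def split: if_splits)

lemma corner_pairs:
  assumes v: "v \<in> K" "v \<in> e" and e: "e \<in> W \<or> (\<exists>v\<in>K. e = {v, r v}) \<or> (\<exists>v\<in>K. e = {v, g v})"
  shows "e \<in> {{v, partner v}, {v, r v}, {v, g v}}"
  using e
proof (elim disjE bexE)
  assume "e \<in> W"
  then show ?thesis using corner_edge[OF v(1)] v(2) by simp
next
  fix u assume "u \<in> K" "e = {u, r u}"
  then show ?thesis using v rr by (auto simp: insert_commute)
next
  fix u assume "u \<in> K" "e = {u, g u}"
  then show ?thesis using v gg by (auto simp: insert_commute)
qed

lemma pair_subset: "e \<in> W \<or> (\<exists>v\<in>K. e = {v, r v}) \<or> (\<exists>v\<in>K. e = {v, g v}) \<Longrightarrow> e \<subseteq> V \<and> card e = 2"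
proof (elim disjE bexE)
  show "e \<in> W \<Longrightarrow> e \<subseteq> V \<and> card e = 2" by (rule W_edge)
  show "e \<subseteq> V \<and> card e = 2" if "u \<in> K" "e = {u, r u}" for u
    using that K_subset r_K[OF that(1)] r_neq[OF that(1)] by (auto simp: card_insert_if)
  show "e \<subseteq> V \<and> card e = 2" if "u \<in> K" "e = {u, g u}" for u
    using that K_subset g_K[OF that(1)] g_neq[OF that(1)] by (auto simp: card_insert_if)
qed

lemma even_degree:
  assumes M: "perfect_matching ends nodes edges M" and n: "V = Vn n" and v: "v \<in> V"
  shows "even (mg_degree n (mult M s) v)"
proof -
  let ?A = "{e \<in> En n. v \<in> e}"
  have fin: "finite ?A" unfolding En_def Vn_def by (rule finite_subset[of _ "Pow {1..n}"]) auto
  have En: "e \<in> En n" if "e \<in> W \<or> (\<exists>v\<in>K. e = {v, r v}) \<or> (\<exists>v\<in>K. e = {v, g v})" for e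
    using pair_subset[OF that] n by (simp add: En_def)
  show ?thesis
  proof (cases "v \<in> K")
    case True
    have W: "{v, partner v} \<in> W" using partner[OF True] by simp
    have ne: "{v, partner v} \<noteq> {v, r v}" "{v, partner v} \<noteq> {v, g v}" "{v, r v} \<noteq> {v, g v}"
      using W rail_not_W[OF True] rung_not_W[OF True] r_neq_g[OF True] by (auto simp: doubleton_eq_iff)
    have "mg_degree n (mult M s) v = sum (mult M s) {{v, partner v}, {v, r v}, {v, g v}}"
      unfolding mg_degree_def
    proof (rule sum.mono_neutral_right[OF fin])
      show "{{v, partner v}, {v, r v}, {v, g v}} \<subseteq> ?A" using En W True by auto
      show "\<forall>e\<in>?A - {{v, partner v}, {v, r v}, {v, g v}}. mult M s e = 0"
      proof (rule ballI, rule ccontr)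
        fix e assume e: "e \<in> ?A - {{v, partner v}, {v, r v}, {v, g v}}" "mult M s e \<noteq> 0"
        then have "v \<in> e" by simp
        from corner_pairs[OF True this mult_outside[OF e(2)]] show False using e(1) by blast
      qed
    qed
    also have "\<dots> = path_mult M {v, partner v} + mult M s {v, r v} + mult M s {v, g v}"
      using ne mult_path[OF W] by simp
    \<comment> \<open>The degree is 1 + 1 + 0 in a matched square. Otherwise it is twice the
      multiplicity of the 1-edge at a corner off the selected rail, and 1 + (1 + 2) = 4 on it, as
      exactly one end of the rung has a doubled 1-edge.\<close>
    finally show ?thesis
      using mult_rail[OF True, of M s] mult_rung[OF True, of M s] matching_corner[OF M True]
      by (auto simp: path_mult_def)
  next
    case False
    then have u: "v \<in> V - K" using v by blast
    obtain w where w: "{v, w} \<in> W" using pass_nbr[OF u] .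
    have w': "{v, other v w} \<in> W" "other v w \<noteq> w" using other_other[OF u w] other(2)[OF u w] by auto
    have "mg_degree n (mult M s) v = sum (mult M s) {{v, w}, {v, other v w}}"
      unfolding mg_degree_def
    proof (rule sum.mono_neutral_right[OF fin])
      show "{{v, w}, {v, other v w}} \<subseteq> ?A" using En w w' by auto
      show "\<forall>e\<in>?A - {{v, w}, {v, other v w}}. mult M s e = 0"
      proof (rule ballI, rule ccontr)
        fix e assume e: "e \<in> ?A - {{v, w}, {v, other v w}}" "mult M s e \<noteq> 0"
        then have eW: "e \<in> W" using mult_outside[OF e(2)] u r_K g_K by auto
        obtain a b where ab: "e = {a, b}" using W_pair[OF eW] .
        then obtain x where "e = {v, x}" using e(1) by (auto simp: insert_commute)
        then show False using other(1)[OF u w, of x] e(1) eW by auto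
      qed
    qed
    also have "\<dots> = path_mult M {v, w} + path_mult M {v, other v w}"
      using w w' mult_path by (simp add: doubleton_eq_iff)
    finally show ?thesis
      using matching_pass[OF M u w] matching_pass[OF M u w'(1)] by (simp add: path_mult_def)
  qed
qed

text \<open>The vertices reachable from \<open>u\<close> form a set crossed by no 1-edge and by no
  rail, so \<open>con\<close> makes it all of \<open>V\<close>. A rail missing from the tour is
  bypassed within its square.\<close>

lemma is_tour_mult:
  assumes M: "perfect_matching ends nodes edges M" and n: "V = Vn n"
    and con: "\<And>U. U \<subseteq> V \<Longrightarrow> uncut W U \<Longrightarrow> (\<And>v. v \<in> K \<Longrightarrow> v \<in> U \<longleftrightarrow> r v \<in> U) \<Longrightarrow> U = {} \<or> U = V"
  shows "is_tour n (mult M s)"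
  unfolding is_tour_def
proof (intro conjI allI impI ballI)
  show "mult M s e = 0" if "e \<notin> En n" for e
    using mult_outside[of M s e] pair_subset[of e] that n by (auto simp: En_def)
  show "even (mg_degree n (mult M s) v)" if "v \<in> Vn n" for v using even_degree[OF M n] that n by simp
  fix u v assume u: "u \<in> Vn n" and v: "v \<in> Vn n"
  let ?R = "(mg_adj (mult M s))\<^sup>*\<^sup>*"
  have step: "?R u b" if "?R u a" "a \<noteq> b" "0 < mult M s {a, b}" for a b
    using that by (meson mg_adj_def rtranclp.rtrancl_into_rtrancl)
  define U where "U = {x \<in> V. ?R u x}"
  have "uncut W U"
    unfolding uncut_def
  proof
    fix e assume e: "e \<in> W"
    then obtain a b where ab: "e = {a, b}" "a \<noteq> b" "a \<in> V" "b \<in> V" using W_pair by metis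
    have "0 < mult M s e" using mult_path[OF e] by (simp add: path_mult_def)
    then have "?R u a \<longleftrightarrow> ?R u b" using step[of a b] step[of b a] ab by (auto simp: insert_commute)
    then show "e \<subseteq> U \<or> e \<inter> U = {}" using ab by (auto simp: U_def)
  qed
  moreover have imp: "r x \<in> U" if x: "x \<in> K" "x \<in> U" for x
  proof (cases "0 < mult M s {x, r x}")
    case True
    then show ?thesis using step[of x "r x"] x r_K K_subset r_neq[OF x(1)] by (auto simp: U_def)
  next
    case False
    then have ns: "Square (square x) \<notin> M" "\<not> selected s x"
      using mult_rail[OF x(1), of M s] by (auto split: if_splits)
    have gx: "g x \<in> K" "r (g x) \<in> K" "r x \<in> K" using x g_K r_K by auto
    have sq: "square (g x) = square x" "square (r x) = square x"
      by (rule square_eq[OF x(1)]; simp add: square_def)+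
    \<comment> \<open>The bypass runs \<open>x\<close>, \<open>g x\<close>,
      \<open>r (g x) = g (r x)\<close>, \<open>r x\<close>: both rungs and the selected rail are
      present.\<close>
    have 1: "0 < mult M s {x, g x}"
      using mult_rung[OF x(1), of M s] ns by (auto simp: path_mult_def)
    have 2: "0 < mult M s {g x, r (g x)}"
      using mult_rail[OF gx(1), of M s] selected(2)[OF x(1)] ns by simp
    have 3: "0 < mult M s {r x, g (r x)}"
      using mult_rung[OF gx(3), of M s] ns sq by (auto simp: path_mult_def)
    have "?R u x" using x by (simp add: U_def)
    then have "?R u (g x)" using step 1 g_neq[OF x(1)] by metis
    then have "?R u (g (r x))" using step 2 r_neq[OF gx(1)] rg[OF x(1)] by metis
    then have "?R u (r x)" using step[of "g (r x)" "r x"] 3 g_neq[OF gx(3)] by (simp add: insert_commute)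
    then show ?thesis using gx(3) K_subset by (auto simp: U_def)
  qed
  have "x \<in> U \<longleftrightarrow> r x \<in> U" if x: "x \<in> K" for x
    using imp[OF x] imp[OF r_K[OF x]] rr[OF x] by auto
  ultimately have "U = {} \<or> U = V" by (intro con) (auto simp: U_def)
  moreover have "u \<in> U" using u n by (simp add: U_def)
  ultimately show "?R u v" using v n by (auto simp: U_def)
qed

theorem in_TSP:
  assumes n: "V = Vn n"
    and con: "\<And>U. U \<subseteq> V \<Longrightarrow> uncut W U \<Longrightarrow> (\<And>v. v \<in> K \<Longrightarrow> v \<in> U \<longleftrightarrow> r v \<in> U) \<Longrightarrow> U = {} \<or> U = V"
    and y: "\<And>e. e \<in> W \<Longrightarrow> y e = 5/4" "\<And>v. v \<in> K \<Longrightarrow> y {v, r v} = 3/4" "\<And>v. v \<in> K \<Longrightarrow> y {v, g v} = 3/4"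
      "\<And>e. e \<notin> W \<Longrightarrow> \<forall>v\<in>K. e \<noteq> {v, r v} \<and> e \<noteq> {v, g v} \<Longrightarrow> y e = 0"
  shows "y \<in> TSP_Kn n"
proof -
  obtain p where p: "set_pmf p \<subseteq> {M. perfect_matching ends nodes edges M}"
    "\<forall>f\<in>edges. measure_pmf.prob p {M. f \<in> M} = weight f"
    using edmonds_imp_pm_hull[OF edmonds_weight] by (auto simp: pm_hull_def)
  have fin: "finite (set_pmf p)"
    by (rule finite_subset[of _ "Pow edges"]) (use p(1) finite_edges in \<open>auto simp: perfect_matching_def\<close>)
  have total: "(\<Sum>M\<in>set_pmf p. pmf p M) = 1" by (rule sum_pmf_eq_1[OF fin]) simp
  have prob: "(\<Sum>M\<in>set_pmf p. pmf p M * (if f \<in> M then 1 else 0)) = weight f" if "f \<in> edges" for f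
  proof -
    have "(\<Sum>M\<in>set_pmf p. pmf p M * (if f \<in> M then 1 else 0)) = (\<Sum>M\<in>set_pmf p \<inter> {M. f \<in> M}. pmf p M)"
      using fin by (simp add: sum.inter_restrict if_distrib cong: if_cong)
    also have "\<dots> = measure_pmf.prob p (set_pmf p \<inter> {M. f \<in> M})"
      using fin by (simp add: measure_measure_pmf_finite)
    also have "\<dots> = measure_pmf.prob p {M. f \<in> M}"
      using measure_Int_set_pmf[of p "{M. f \<in> M}"] by (subst Int_commute)
    finally show ?thesis using p(2) that by simp
  qed
  let ?c = "\<lambda>(M, s::bool). pmf p M / 2"
  have expand: "(\<Sum>i\<in>set_pmf p \<times> UNIV. ?c i * real (case i of (M, s) \<Rightarrow> mult M s e))
      = (\<Sum>M\<in>set_pmf p. pmf p M * ((real (mult M True e) + real (mult M False e)) / 2))" for e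
    unfolding sum.cartesian_product' by (simp add: UNIV_bool algebra_simps add_divide_distrib)
  \<comment> \<open>Averaged over the bit \<open>s\<close>, the multiplicity of \<open>e\<close> is
    affine in the indicator that one fixed edge \<open>f\<close> is matched, so its expectation over
    \<open>M\<close> is determined by \<open>weight f\<close>.\<close>
  have affine: "(\<Sum>M\<in>set_pmf p. pmf p M * ((real (mult M True e) + real (mult M False e)) / 2)) = a + b * weight f"
    if "f \<in> edges" and "\<And>M. M \<in> set_pmf p \<Longrightarrow>
      (real (mult M True e) + real (mult M False e)) / 2 = a + b * (if f \<in> M then 1 else 0)" for e f a b
  proof -
    have "(\<Sum>M\<in>set_pmf p. pmf p M * ((real (mult M True e) + real (mult M False e)) / 2))
        = (\<Sum>M\<in>set_pmf p. a * pmf p M + b * (pmf p M * (if f \<in> M then 1 else 0)))"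
      using that(2) by (intro sum.cong refl) (simp add: algebra_simps)
    also have "\<dots> = a + b * weight f"
      using total prob[OF that(1)] by (simp add: sum.distrib sum_distrib_left[symmetric])
    finally show ?thesis .
  qed
  have pm: "perfect_matching ends nodes edges M" if "M \<in> set_pmf p" for M using p(1) that by blast
  show ?thesis
  proof (rule TSP_KnI[where I = "set_pmf p \<times> UNIV" and c = ?c and t = "\<lambda>(M, s). mult M s"])
    show "finite (set_pmf p \<times> (UNIV :: bool set))" using fin by simp
    show "0 \<le> ?c i" for i by (simp add: case_prod_beta)
    show "sum ?c (set_pmf p \<times> UNIV) = 1"
      using total unfolding sum.cartesian_product' by (simp add: UNIV_bool)
    show "is_tour n (case i of (M, s) \<Rightarrow> mult M s)" if i0: "i \<in> set_pmf p \<times> UNIV" for i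
    proof -
      obtain M s where i: "i = (M, s)" "M \<in> set_pmf p" using i0 by auto
      have "is_tour n (mult M s)" by (rule is_tour_mult[OF pm[OF i(2)] n con])
      then show ?thesis using i(1) by simp
    qed
    fix e
    have "y e = (\<Sum>M\<in>set_pmf p. pmf p M * ((real (mult M True e) + real (mult M False e)) / 2))" (is "_ = ?S")
    proof -
      consider (path) "e \<in> W" | (rail) v where "v \<in> K" "e = {v, r v}" | (rung) v where "v \<in> K" "e = {v, g v}"
        | (none) "e \<notin> W" "\<forall>v\<in>K. e \<noteq> {v, r v} \<and> e \<noteq> {v, g v}" by blast
      then show ?thesis
      proof cases
        case path
        have "Path e \<in> edges" using path by (simp add: edges_def)
        moreover have "(real (mult M True e) + real (mult M False e)) / 2 = 1 + 1 * (if Path e \<in> M then 1 else 0)" for M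
          using mult_path[OF path] by (simp add: path_mult_def)
        ultimately have "?S = 1 + 1 * weight (Path e)" by (rule affine)
        then show ?thesis using y(1)[OF path] by simp
      next
        case rail
        have sel: "selected False v \<longleftrightarrow> \<not> selected True v" by (auto simp: selected_def)
        have "Square (square v) \<in> edges" using rail by (simp add: edges_def)
        moreover have "(real (mult M True e) + real (mult M False e)) / 2
            = 1/2 + 1/2 * (if Square (square v) \<in> M then 1 else 0)" for M
          unfolding rail(2) mult_rail[OF rail(1)] sel by simp
        ultimately have "?S = 1/2 + 1/2 * weight (Square (square v))" by (rule affine)
        then show ?thesis using y(2)[OF rail(1)] rail(2) by simp
      next
        case rung
        have sel: "selected False v \<longleftrightarrow> \<not> selected True v" by (auto simp: selected_def)
        have "Square (square v) \<in> edges" using rung by (simp add: edges_def)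
        \<comment> \<open>In an unmatched square the two bits read off the 1-edges at the two ends
          of the rung, exactly one of which is doubled: (1 + 2) / 2.\<close>
        moreover have "(real (mult M True e) + real (mult M False e)) / 2
            = 3/2 + (- 3/2) * (if Square (square v) \<in> M then 1 else 0)" if M: "M \<in> set_pmf p" for M
          unfolding rung(2) mult_rung[OF rung(1)] sel
          using matching_corner(2)[OF pm[OF M] rung(1)] by (auto simp: path_mult_def)
        ultimately have "?S = 3/2 + (- 3/2) * weight (Square (square v))" by (rule affine)
        then show ?thesis using y(3)[OF rung(1)] rung(2) by simp
      next
        case none
        then have "mult M s e = 0" for M s using mult_outside[of M s e] by blast
        then show ?thesis using y(4)[OF none] by simp
      qed
    qed
    then show "y e = (\<Sum>i\<in>set_pmf p \<times> UNIV. ?c i * real ((case i of (M, s) \<Rightarrow> mult M s) e))"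
      using expand[of e] by (simp add: case_prod_beta)
  qed
qed

end

section \<open>Half-cyclic points\<close>

text \<open>A disjoint union of 4-cycles in functional form: \<open>r\<close> and \<open>g\<close>
  give the two edges of \<open>H\<close> at a vertex, and since they commute, alternating between
  them closes up after four steps.\<close>

definition mates :: "nat set set \<Rightarrow> (nat \<Rightarrow> nat) \<Rightarrow> (nat \<Rightarrow> nat) \<Rightarrow> bool" where
  "mates H r g \<longleftrightarrow>
     (\<forall>v\<in>\<Union>H. r v \<in> \<Union>H \<and> g v \<in> \<Union>H \<and> r (r v) = v \<and> g (g v) = v \<and> r (g v) = g (r v)
       \<and> r v \<noteq> v \<and> g v \<noteq> v \<and> r v \<noteq> g v)
     \<and> (\<forall>e. e \<in> H \<longleftrightarrow> (\<exists>v\<in>\<Union>H. e = {v, r v} \<or> e = {v, g v}))"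

text \<open>Which pair of opposite edges is called \<open>r\<close> is arbitrary at this point; the
  rails are chosen later by \<open>resolve_all\<close>.\<close>

lemma C4_mates:
  assumes "is_C4 n F"
  shows "\<exists>r g. mates F r g"
proof -
  obtain a b c d where d: "distinct [a, b, c, d]" and F: "F = {{a, b}, {b, c}, {c, d}, {d, a}}"
    using assms by (auto simp: is_C4_def)
  define r where "r v = (if v = a then b else if v = b then a else if v = c then d else c)" for v
  define g where "g v = (if v = a then d else if v = d then a else if v = b then c else b)" for v
  have U: "\<Union>F = {a, b, c, d}" unfolding F by auto
  have r: "r a = b" "r b = a" "r c = d" "r d = c" and g: "g a = d" "g d = a" "g b = c" "g c = b"
    using d by (auto simp: r_def g_def)
  have "mates F r g"
    unfolding mates_def U
  proof (intro conjI allI)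
    show "\<forall>v\<in>{a, b, c, d}. r v \<in> {a, b, c, d} \<and> g v \<in> {a, b, c, d} \<and> r (r v) = v \<and> g (g v) = v
        \<and> r (g v) = g (r v) \<and> r v \<noteq> v \<and> g v \<noteq> v \<and> r v \<noteq> g v"
      using d by (simp add: r g)
    show "e \<in> F \<longleftrightarrow> (\<exists>v\<in>{a, b, c, d}. e = {v, r v} \<or> e = {v, g v})" for e
    proof -
      have sym: "{b, a} = {a, b}" "{d, c} = {c, d}" "{a, d} = {d, a}" "{c, b} = {b, c}" by blast+
      show ?thesis unfolding F by (simp only: bex_simps r g sym insert_iff empty_iff) argo
    qed
  qed
  then show ?thesis by blast
qed

text \<open>Disjointness makes the cycle through a vertex unique, so the mates of the single cycles
  can be pasted together along \<open>fam\<close>.\<close>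

lemma union_disjoint_C4_mates:
  assumes "union_disjoint_C4 n H"
  shows "\<exists>r g. mates H r g"
proof -
  from assms obtain \<C> where C: "\<forall>F\<in>\<C>. is_C4 n F" "\<Union>\<C> = H"
    and dj: "\<forall>F\<in>\<C>. \<forall>G\<in>\<C>. F \<noteq> G \<longrightarrow> \<Union>F \<inter> \<Union>G = {}"
    unfolding union_disjoint_C4_def by (elim exE conjE)
  have disj: "F = G" if "F \<in> \<C>" "G \<in> \<C>" "v \<in> \<Union>F" "v \<in> \<Union>G" for F G v
  proof (rule ccontr)
    assume "F \<noteq> G"
    then have "\<Union>F \<inter> \<Union>G = {}" using dj that(1,2) by simp
    then show False using that(3,4) by (metis Int_iff empty_iff)
  qed
  have "\<forall>F\<in>\<C>. \<exists>p. mates F (fst p) (snd p)"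
  proof
    fix F assume "F \<in> \<C>"
    then obtain r g where "mates F r g" using C4_mates C(1) by metis
    then show "\<exists>p. mates F (fst p) (snd p)" by (intro exI[of _ "(r, g)"]) simp
  qed
  then obtain m where m: "\<And>F. F \<in> \<C> \<Longrightarrow> mates F (fst (m F)) (snd (m F))" by metis
  define fam where "fam v = (SOME F. F \<in> \<C> \<and> v \<in> \<Union>F)" for v
  define r where "r v = fst (m (fam v)) v" for v
  define g where "g v = snd (m (fam v)) v" for v
  have fam: "fam v = F" if "F \<in> \<C>" "v \<in> \<Union>F" for v F
  proof -
    have "fam v \<in> \<C> \<and> v \<in> \<Union>(fam v)"
      unfolding fam_def by (rule someI[of "\<lambda>F. F \<in> \<C> \<and> v \<in> \<Union>F" F]) (rule conjI[OF that])
    then show ?thesis using disj[OF _ that(1) _ that(2)] by simp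
  qed
  have rg: "r v = fst (m F) v" "g v = snd (m F) v" if "F \<in> \<C>" "v \<in> \<Union>F" for v F
    using fam[OF that] by (simp_all add: r_def g_def)
  have v: "r v \<in> \<Union>F \<and> g v \<in> \<Union>F \<and> r (r v) = v \<and> g (g v) = v \<and> r (g v) = g (r v)
      \<and> r v \<noteq> v \<and> g v \<noteq> v \<and> r v \<noteq> g v" if F: "F \<in> \<C>" "v \<in> \<Union>F" for v F
  proof -
    let ?r = "fst (m F)" and ?g = "snd (m F)"
    have *: "?r v \<in> \<Union>F \<and> ?g v \<in> \<Union>F \<and> ?r (?r v) = v \<and> ?g (?g v) = v \<and> ?r (?g v) = ?g (?r v)
      \<and> ?r v \<noteq> v \<and> ?g v \<noteq> v \<and> ?r v \<noteq> ?g v"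
      using m[OF F(1)] F(2) unfolding mates_def by (elim conjE) (rule bspec)
    have "r (?r v) = ?r (?r v)" "g (?r v) = ?g (?r v)" "r (?g v) = ?r (?g v)" "g (?g v) = ?g (?g v)"
      using rg[OF F(1), of "?r v"] rg[OF F(1), of "?g v"] * by simp_all
    then show ?thesis using * unfolding rg[OF F] by simp
  qed
  have e: "e \<in> F \<longleftrightarrow> (\<exists>v\<in>\<Union>F. e = {v, r v} \<or> e = {v, g v})" if F: "F \<in> \<C>" for e F
  proof -
    have "e \<in> F \<longleftrightarrow> (\<exists>v\<in>\<Union>F. e = {v, fst (m F) v} \<or> e = {v, snd (m F) v})"
      using m[OF F] unfolding mates_def by (elim conjE) (rule spec)
    also have "\<dots> \<longleftrightarrow> (\<exists>v\<in>\<Union>F. e = {v, r v} \<or> e = {v, g v})"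
      using rg[OF F] by (intro bex_cong refl) simp
    finally show ?thesis .
  qed
  have UH: "v \<in> \<Union>H \<longleftrightarrow> (\<exists>F\<in>\<C>. v \<in> \<Union>F)" for v using C(2) by blast
  have "mates H r g"
    unfolding mates_def
  proof (intro conjI ballI allI)
    fix u assume "u \<in> \<Union>H"
    then obtain F where F: "F \<in> \<C>" "u \<in> \<Union>F" using UH by blast
    note uF = v[OF F, THEN conjunct1] v[OF F, THEN conjunct2, THEN conjunct1]
    show "r u \<in> \<Union>H" unfolding UH using uF(1) F(1) by (rule bexI)
    show "g u \<in> \<Union>H" unfolding UH using uF(2) F(1) by (rule bexI)
    show "r (r u) = u" "g (g u) = u" "r (g u) = g (r u)" "r u \<noteq> u" "g u \<noteq> u" "r u \<noteq> g u"
      using v[OF F] by simp_all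
  next
    fix f
    have "f \<in> H \<longleftrightarrow> (\<exists>F\<in>\<C>. f \<in> F)" using C(2) by blast
    also have "\<dots> \<longleftrightarrow> (\<exists>F\<in>\<C>. \<exists>v\<in>\<Union>F. f = {v, r v} \<or> f = {v, g v})" using e by simp
    also have "\<dots> \<longleftrightarrow> (\<exists>v\<in>\<Union>H. f = {v, r v} \<or> f = {v, g v})" unfolding Bex_def UH by blast
    finally show "f \<in> H \<longleftrightarrow> (\<exists>v\<in>\<Union>H. f = {v, r v} \<or> f = {v, g v})" .
  qed
  then show ?thesis by blast
qed

section \<open>Degrees and cuts of a half-cyclic point\<close>

lemma En_pair: "e \<in> En n \<Longrightarrow> \<exists>a b. e = {a, b} \<and> a \<noteq> b \<and> a \<in> Vn n \<and> b \<in> Vn n"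
  by (auto simp: En_def card_2_iff)

lemma finite_En: "finite (En n)"
  by (rule finite_subset[of _ "Pow {1..n}"]) (auto simp: En_def Vn_def)

lemma in_delta:
  assumes "a \<noteq> b"
  shows "{a, b} \<in> delta n U \<longleftrightarrow> {a, b} \<in> En n \<and> (a \<in> U) \<noteq> (b \<in> U)"
proof -
  have "{a, b} \<inter> U = (if a \<in> U then {a} else {}) \<union> (if b \<in> U then {b} else {})" by auto
  then show ?thesis using assms by (auto simp: delta_def)
qed

lemma sum_half_integral:
  assumes x: "\<forall>e\<in>En n. x e \<in> {0, 1/2, 1}" and D: "D \<subseteq> En n"
  shows "sum x D = real (card (D \<inter> W_edges n x)) + real (card (D \<inter> H_edges n x)) / 2"
proof -
  have fin: "finite D" using D finite_En finite_subset by blast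
  have "sum x D = (\<Sum>e\<in>D. (if e \<in> W_edges n x then 1 else 0) + (if e \<in> H_edges n x then 1/2 else 0))"
    using x D by (intro sum.cong) (auto simp: W_edges_def H_edges_def)
  then show ?thesis using fin by (simp add: sum.distrib sum.inter_restrict[symmetric])
qed

text \<open>The degree equation x(delta(v)) = 2 decides the number of 1-edges: a vertex on a square
  has two half edges and thus one 1-edge, any other vertex has no half edge and thus two
  1-edges.\<close>

lemma half_cyclic_square_graph:
  assumes hc: "half_cyclic n x" and mates: "mates (H_edges n x) r g"
  shows "square_graph (Vn n) (W_edges n x) (\<Union>(H_edges n x)) r g"
proof -
  let ?W = "W_edges n x" and ?H = "H_edges n x" and ?K = "\<Union>(H_edges n x)"
  have K: "r v \<in> ?K" "g v \<in> ?K" "r (r v) = v" "g (g v) = v" "r (g v) = g (r v)" "r v \<noteq> v" "g v \<noteq> v" "r v \<noteq> g v"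
    if "v \<in> ?K" for v
    using mates that unfolding mates_def by blast+
  have H: "e \<in> ?H \<longleftrightarrow> (\<exists>v\<in>?K. e = {v, r v} \<or> e = {v, g v})" for e
    using mates unfolding mates_def by blast
  have degree: "real (card {w. {v, w} \<in> ?W}) + real (card {e \<in> ?H. v \<in> e}) / 2 = 2" if v: "v \<in> Vn n" for v
  proof -
    have D: "delta n {v} = {e \<in> En n. v \<in> e}"
    proof (intro set_eqI)
      fix e
      show "e \<in> delta n {v} \<longleftrightarrow> e \<in> {e \<in> En n. v \<in> e}"
        by (cases "v \<in> e") (auto simp: delta_def)
    qed
    have "sum x (delta n {v}) = 2" using hc v by (simp add: half_cyclic_def SUBT_def)
    moreover have "sum x (delta n {v})
        = real (card (delta n {v} \<inter> ?W)) + real (card (delta n {v} \<inter> ?H)) / 2"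
      by (rule sum_half_integral) (use hc in \<open>auto simp: half_cyclic_def delta_def\<close>)
    moreover have "delta n {v} \<inter> ?H = {e \<in> ?H. v \<in> e}" using D by (auto simp: H_edges_def)
    moreover have "delta n {v} \<inter> ?W = (\<lambda>w. {v, w}) ` {w. {v, w} \<in> ?W}"
    proof (intro set_eqI iffI)
      fix e assume e: "e \<in> delta n {v} \<inter> ?W"
      then have "v \<in> e" "e \<in> En n" using D by auto
      then obtain w where "e = {v, w}" using En_pair by (metis insertE insert_commute singletonD)
      then show "e \<in> (\<lambda>w. {v, w}) ` {w. {v, w} \<in> ?W}" using e by blast
    next
      fix e assume "e \<in> (\<lambda>w. {v, w}) ` {w. {v, w} \<in> ?W}"
      then show "e \<in> delta n {v} \<inter> ?W" using D by (auto simp: W_edges_def)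
    qed
    moreover have "card ((\<lambda>w. {v, w}) ` {w. {v, w} \<in> ?W}) = card {w. {v, w} \<in> ?W}"
      by (rule card_image) (auto simp: inj_on_def doubleton_eq_iff)
    ultimately show ?thesis by simp
  qed
  show ?thesis
  proof
    show "finite (Vn n)" by (simp add: Vn_def)
    show KV: "?K \<subseteq> Vn n" by (auto simp: H_edges_def En_def)
    show "e \<subseteq> Vn n \<and> card e = 2" if "e \<in> ?W" for e using that by (auto simp: W_edges_def En_def)
    show "card {w. {v, w} \<in> ?W} = 1" if v: "v \<in> ?K" for v
    proof -
      have "{e \<in> ?H. v \<in> e} = {{v, r v}, {v, g v}}"
      proof (intro set_eqI iffI)
        fix e assume e: "e \<in> {e \<in> ?H. v \<in> e}"
        then have eH: "e \<in> ?H" and ve: "v \<in> e" by simp_all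
        obtain u where u: "u \<in> ?K" "e = {u, r u} \<or> e = {u, g u}" using H[THEN iffD1, OF eH] by (rule bexE)
        from u(2) show "e \<in> {{v, r v}, {v, g v}}"
        proof
          assume "e = {u, r u}"
          moreover from this ve have "v = u \<or> v = r u" by simp
          ultimately show ?thesis using K(3)[OF u(1)] by (elim disjE) (simp_all add: insert_commute)
        next
          assume "e = {u, g u}"
          moreover from this ve have "v = u \<or> v = g u" by simp
          ultimately show ?thesis using K(4)[OF u(1)] by (elim disjE) (simp_all add: insert_commute)
        qed
      next
        fix e assume "e \<in> {{v, r v}, {v, g v}}"
        then have eq: "e = {v, r v} \<or> e = {v, g v}" by simp
        have "e \<in> ?H" unfolding H using eq v by (rule bexI)
        moreover have "v \<in> e" using eq by (elim disjE) simp_all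
        ultimately show "e \<in> {e \<in> ?H. v \<in> e}" by simp
      qed
      moreover have "{v, r v} \<noteq> {v, g v}" using K(8)[OF v] by (auto simp: doubleton_eq_iff)
      ultimately have "card {e \<in> ?H. v \<in> e} = 2" by simp
      moreover have "v \<in> Vn n" using v KV by blast
      ultimately have "real (card {w. {v, w} \<in> ?W}) = 1" using degree[of v] by simp
      then show ?thesis by simp
    qed
    show "card {w. {v, w} \<in> ?W} = 2" if v: "v \<in> Vn n - ?K" for v
    proof -
      have "e \<notin> ?H" if "v \<in> e" for e using v that by blast
      then have "{e \<in> ?H. v \<in> e} = {}" by blast
      then have "card {e \<in> ?H. v \<in> e} = 0" by (simp only: card.empty)
      then have "real (card {w. {v, w} \<in> ?W}) = 2" using degree[of v] v by simp
      then show ?thesis by simp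
    qed
  qed (fact K)+
qed

text \<open>Without 1-edges in the cut, each edge of its support contributes 1/2 to a total of at
  least 2. The constraints x(delta(U)) >= 2 enter the proof only here.\<close>

lemma SUBT_cut:
  assumes hc: "half_cyclic n x" and U: "U \<subseteq> Vn n" "U \<noteq> {}" "U \<noteq> Vn n" and W: "uncut (W_edges n x) U"
  shows "4 \<le> card (delta n U \<inter> H_edges n x)"
proof -
  have "2 \<le> sum x (delta n U)" using hc U by (auto simp: half_cyclic_def SUBT_def)
  also have "\<dots> = real (card (delta n U \<inter> W_edges n x)) + real (card (delta n U \<inter> H_edges n x)) / 2"
    by (rule sum_half_integral) (use hc in \<open>auto simp: half_cyclic_def delta_def\<close>)
  also have "delta n U \<inter> W_edges n x = {}"
    using W by (force simp: delta_def uncut_def En_def Int_absorb2)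
  finally show ?thesis by simp
qed

theorem mainTheorem6:
  fixes n :: nat and x y :: "nat set \<Rightarrow> real"
  assumes "n \<ge> 3"
    and "half_cyclic n x"
    and "union_disjoint_C4 n (H_edges n x)"
    and "\<forall>e\<in>W_edges n x. y e = 5/4"
    and "\<forall>e\<in>H_edges n x. y e = 3/2 * x e"
    and "\<forall>e. e \<notin> supp_edges n x \<longrightarrow> y e = 0"
  shows "y \<in> TSP_Kn n"
proof -
  let ?V = "Vn n" and ?W = "W_edges n x" and ?H = "H_edges n x"
  define K where "K = \<Union>?H"
  obtain r g where "mates ?H r g" using union_disjoint_C4_mates assms(3) by blast
  then interpret sq: square_graph ?V ?W K r g
    unfolding K_def by (rule half_cyclic_square_graph[OF assms(2)])
  have H: "e \<in> ?H \<longleftrightarrow> (\<exists>v\<in>K. e = {v, r v} \<or> e = {v, g v})" for e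
    using \<open>mates ?H r g\<close> unfolding mates_def K_def by blast
  have disjoint: "e \<notin> ?W" if "e \<in> ?H" for e using that by (simp add: W_edges_def H_edges_def)
  have H_En: "e \<in> En n" if "e \<in> ?H" for e using that by (simp add: H_edges_def)
  \<comment> \<open>With no square resolved this is connectivity of the support: a disconnecting set
    would have no half edge in its cut instead of at least four.\<close>
  have "sq.resolved_connected {} {}"
    unfolding sq.resolved_connected_def
  proof (intro allI impI, elim conjE, rule ccontr)
    fix U assume U: "U \<subseteq> ?V" "uncut ?W U" "\<forall>v\<in>K - {}. (v \<in> U \<longleftrightarrow> r v \<in> U) \<and> (v \<in> U \<longleftrightarrow> g v \<in> U)"
      "\<not> (U = {} \<or> U = ?V)"
    have "e \<notin> delta n U" if e: "e \<in> ?H" for e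
    proof -
      obtain v where v: "v \<in> K" "e = {v, r v} \<or> e = {v, g v}" using H[THEN iffD1, OF e] by (rule bexE)
      have "(v \<in> U \<longleftrightarrow> r v \<in> U) \<and> (v \<in> U \<longleftrightarrow> g v \<in> U)" using U(3) v(1) by blast
      then show ?thesis
        using v(2) in_delta[OF sq.r_neq[OF v(1), symmetric]] in_delta[OF sq.g_neq[OF v(1), symmetric]]
        by (elim disjE) auto
    qed
    then have "delta n U \<inter> ?H = {}" by blast
    then show False using SUBT_cut[OF assms(2) U(1) _ _ U(2)] U(4) by simp
  qed
  then obtain X where X: "sq.mates_closed X" "sq.resolved_connected X K"
    using sq.resolve_all[of "{}" "{}"] by (auto simp: sq.mates_closed_def)
  \<comment> \<open>From here on \<open>r'\<close> runs along the chosen rails and \<open>g'\<close>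
    along the rungs.\<close>
  define r' where "r' = sq.swap X r g"
  define g' where "g' = sq.swap X g r"
  interpret res: square_graph ?V ?W K r' g'
    unfolding r'_def g'_def by (rule sq.swap_square_graph[OF X(1)])
  have H': "e \<in> ?H \<longleftrightarrow> (\<exists>v\<in>K. e = {v, r' v} \<or> e = {v, g' v})" for e
    unfolding H r'_def g'_def sq.swap_def by (intro bex_cong refl) auto
  have H'_mem: "{v, r' v} \<in> ?H" "{v, g' v} \<in> ?H" if "v \<in> K" for v
    by (rule H'[THEN iffD2], rule bexI[where x = v], simp, rule that)+
  interpret res: bridgeless_square_graph ?V ?W K r' g'
  proof
    show "{v, g' v} \<notin> ?W" "{v, r' v} \<notin> ?W" if "v \<in> K" for v
      using disjoint H'_mem[OF that] by simp_all
    fix S v assume S: "S \<subseteq> ?V" "uncut ?W S" "\<And>u. u \<in> K \<Longrightarrow> u \<in> S \<longleftrightarrow> g' u \<in> S"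
      and v: "v \<in> K" "v \<in> S" "r' v \<notin> S"
    show "\<exists>u\<in>K \<inter> S. r' u \<notin> S \<and> u \<noteq> v \<and> u \<noteq> g' v"
    proof (rule ccontr)
      assume neg: "\<not> ?thesis"
      \<comment> \<open>If no other square crosses, the cut contains at most the two rails of the
        square of \<open>v\<close>, short of the four half edges that \<open>SUBT_cut\<close>
        demands.\<close>
      have "delta n S \<inter> ?H \<subseteq> {{v, r' v}, {g' v, r' (g' v)}}"
      proof
        fix e assume e: "e \<in> delta n S \<inter> ?H"
        then have "e \<in> ?H" by simp
        then obtain u where u: "u \<in> K" "e = {u, r' u} \<or> e = {u, g' u}" using H'[THEN iffD1] by (metis (no_types, lifting))
        have "e \<noteq> {u, g' u}" using e S(3)[OF u(1)] in_delta[of u "g' u" n S] res.g_neq[OF u(1)] by auto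
        then have eu: "e = {u, r' u}" using u(2) by blast
        then have "(u \<in> S) \<noteq> (r' u \<in> S)" using e in_delta[of u "r' u" n S] res.r_neq[OF u(1)] by auto
        then obtain w where w: "w \<in> K" "w \<in> S" "r' w \<notin> S" "e = {w, r' w}"
          using eu u(1) res.r_K[OF u(1)] res.rr[OF u(1)] by (metis insert_commute)
        then have "w = v \<or> w = g' v" using neg by blast
        then show "e \<in> {{v, r' v}, {g' v, r' (g' v)}}" using w(4) by blast
      qed
      then have "card (delta n S \<inter> ?H) \<le> card {{v, r' v}, {g' v, r' (g' v)}}" by (intro card_mono) auto
      also have "\<dots> \<le> 2" by (simp add: card_insert_if)
      finally have "card (delta n S \<inter> ?H) \<le> 2" .
      moreover have "r' v \<in> ?V" using res.r_K[OF v(1)] res.K_subset by blast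
      then have "4 \<le> card (delta n S \<inter> ?H)" using v by (intro SUBT_cut[OF assms(2) S(1) _ _ S(2)]) auto
      ultimately show False by simp
    qed
  qed
  show ?thesis
  proof (rule res.in_TSP[OF refl])
    show "U = {} \<or> U = ?V" if "U \<subseteq> ?V" "uncut ?W U" "\<And>v. v \<in> K \<Longrightarrow> v \<in> U \<longleftrightarrow> r' v \<in> U" for U
      by (rule sq.resolved_connectedD[OF X(2) that(1,2)]) (use that(3) in \<open>auto simp: r'_def\<close>)
    show "y e = 5/4" if "e \<in> ?W" for e using assms(4) that by blast
    have yH: "y e = 3/4" if "e \<in> ?H" for e
    proof -
      have "y e = 3/2 * x e" using assms(5) that by blast
      then show ?thesis using that by (simp add: H_edges_def)
    qed
    show "y {v, r' v} = 3/4" "y {v, g' v} = 3/4" if "v \<in> K" for v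
      using yH H'_mem[OF that] by simp_all
    show "y e = 0" if e: "e \<notin> ?W" "\<forall>v\<in>K. e \<noteq> {v, r' v} \<and> e \<noteq> {v, g' v}" for e
    proof -
      have "e \<notin> ?H" using e(2) H'[THEN iffD1, of e] by auto
      then have "e \<notin> supp_edges n x"
        using e(1) assms(2) by (auto simp: supp_edges_def W_edges_def H_edges_def half_cyclic_def)
      then show ?thesis using assms(6) by blast
    qed
  qed
qed

end
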